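(* For $n\ge2$, $$\sum_{\sigma\in\mathcal D^D_n}q^{\mathrm{Dmaj}(\sigma)}=[2]_q[4]_q\cdots[2n-2]_q\sum_{k=0}^{n-2}\frac{(-1)^kq^{2\binom k2}}{[2]_q[4]_q\cdots[2k]_q}\left(q^{2k+1}[n-1-k]_q+\frac12\left(1-\left(\frac{1-q}{1+q}\right)^{n-k-1}\right)\right).$$
   Context: $B_n$ is the set of words $\sigma=\sigma_1\cdots\sigma_n$ with $\sigma_i\in\{\pm1,\dots,\pm n\}$ and $|\sigma_1|\cdots|\sigma_n|$ a permutation of $[n]$; $\mathrm{neg}(\sigma)$ is the number of negative letters; $D_n=\{\sigma\in B_n:\mathrm{neg}(\sigma)\text{ even}\}$; $\mathcal D^D_n$ is the set of $\sigma\in D_n$ with $\sigma_i\ne i$ for all $i$. Order $\prec$ on nonzero integers: $-1\prec-2\prec\cdots\prec-N\prec1\prec\cdots\prec N$. For a word $w$ of distinct nonzero integers, $\mathrm{maj}_\prec(w)=\sum_{i:w_i\succ w_{i+1}}i$ and $\mathrm{fmaj}(w)=2\mathrm{maj}_\prec(w)+\mathrm{neg}(w)$. For $\sigma\in D_n$, $\mathrm{Dmaj}(\sigma)=\mathrm{fmaj}(\sigma_1\cdots\sigma_{n-1}|\sigma_n|)$. $[m]_q=1+q+\dots+q^{m-1}$; empty products equal $1$. *)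

theory Defs
  imports Main
begin

definition signed_perms :: "nat \<Rightarrow> int list set" where
  "signed_perms n = {w. length w = n \<and> distinct (map abs w) \<and> set (map abs w) = {1..int n}}"

definition neg :: "int list \<Rightarrow> nat" where
  "neg w = length (filter (\<lambda>x. x < 0) w)"

definition even_signed_perms :: "nat \<Rightarrow> int list set" where
  "even_signed_perms n = {w \<in> signed_perms n. even (neg w)}"

definition D_derangements :: "nat \<Rightarrow> int list set" where
  "D_derangements n = {w \<in> even_signed_perms n. \<forall>i<n. w ! i \<noteq> int (i + 1)}"

definition prec_less :: "int \<Rightarrow> int \<Rightarrow> bool" where
  "prec_less a b \<longleftrightarrow> (a < 0 \<and> b > 0) \<or> (a < 0 \<and> b < 0 \<and> b < a) \<or> (a > 0 \<and> b > 0 \<and> a < b)"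

text \<open>maj w = sum of (1-based) positions i with w_i succ w_(i+1).\<close>
definition maj_prec :: "int list \<Rightarrow> nat" where
  "maj_prec w = (\<Sum>i\<in>{1..<length w}. if prec_less (w ! i) (w ! (i - 1)) then i else 0)"

definition fmaj :: "int list \<Rightarrow> nat" where
  "fmaj w = 2 * maj_prec w + neg w"

definition Dmaj :: "int list \<Rightarrow> nat" where
  "Dmaj w = fmaj (butlast w @ [abs (last w)])"

definition qint :: "nat \<Rightarrow> 'a::comm_ring_1 \<Rightarrow> 'a" where
  "qint m q = (\<Sum>i<m. q ^ i)"

end

(* Replacing the last letter by its absolute value turns the sum over the even derangements of
   length n into the sum of q^fmaj over two kinds of type B derangements: those of length n with
   positive last letter, and those of length n - 1 with an odd number of negative letters (coming
   from words that end in -n). Since fmaj has the parity of neg, the second sum is half the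
   difference of the values at q and -q of the derangement polynomial of length n - 1.

   Inserting fixed points into a derangement is a shuffle with an increasing word whose letters
   lie above the letters w_j < j and below the letters w_j > j (Wachs). Hence summing q^fmaj over
   all ways to insert k fixed points into w, with n letters in the end, gives
   q^fmaj(w) [n choose k] with base q^2. The sum over all signed permutations with prescribed last
   letter is a product, and q-binomial inversion isolates the derangements. *)

theory Submission
  imports Defs
begin

section \<open>The q-binomial coefficients and their inversion\<close>

text \<open>Descents compare adjacent letters only. A letter of a derangement lies above or below a
  neighbouring fixed point according to whether it exceeds its own position, which is why the
  inserted fixed points may be treated as equal letters. The obstacle is that one of the two sums
  restricts the last letter, while fixed points may be inserted anywhere. A fixed point in the last
  position is the largest letter n, so admitting only the last letters 1, ..., n-1 selects the
  insertions that leave the last position to the derangement. The shuffle sums are therefore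
  computed separately for the two kinds of last position. The last letter of a derangement never
  exceeds its position, so inserting k fixed points before it costs an extra factor q^(2k). Hence
  the inversion has to carry a geometric weight, and this weight produces the q^(2k+1) of the
  result.\<close>

fun qbinom :: "'a::comm_ring_1 \<Rightarrow> nat \<Rightarrow> nat \<Rightarrow> 'a" where
  "qbinom p n 0 = 1"
| "qbinom p 0 (Suc k) = 0"
| "qbinom p (Suc n) (Suc k) = qbinom p n k + p ^ Suc k * qbinom p n (Suc k)"

lemma qbinom_eq_0: "n < k \<Longrightarrow> qbinom p n k = 0"
  by (induction p n k rule: qbinom.induct) auto

lemma qbinom_same [simp]: "qbinom p n n = 1"
  by (induction n) (auto simp: qbinom_eq_0)

text \<open>The mirrored Pascal rule; the shuffle induction needs both versions. For
  \<open>k > n\<close> the truncated exponent is harmless, because both coefficients on the right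
  vanish.\<close>

lemma qbinom_Suc_Suc':
  "qbinom p (Suc n) (Suc k) = p ^ (n - k) * qbinom p n k + qbinom p n (Suc k)"
proof (induction n arbitrary: k)
  case 0
  show ?case by (cases k) auto
next
  case (Suc n)
  show ?case
  proof (cases k)
    case 0
    have "qbinom p (Suc (Suc n)) 1 = 1 + p * qbinom p (Suc n) 1" by simp
    also have "qbinom p (Suc n) 1 = p ^ n + qbinom p n 1" using Suc[of 0] by simp
    finally show ?thesis using 0 by (simp add: algebra_simps)
  next
    case k: (Suc j)
    show ?thesis
    proof (cases "Suc j \<le> n")
      case True
      then have e: "p ^ (n - j) = p * p ^ (n - Suc j)"
        by (metis Suc_diff_Suc Suc_le_lessD power_Suc)
      have "qbinom p (Suc (Suc n)) (Suc k) = qbinom p (Suc n) k + p ^ Suc k * qbinom p (Suc n) (Suc k)"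
        by simp
      also have "\<dots> = (p ^ (n - j) * qbinom p n j + qbinom p n k)
          + p ^ Suc k * (p ^ (n - k) * qbinom p n k + qbinom p n (Suc k))"
        using Suc[of j] Suc[of k] k by (simp only:)
      also have "\<dots> = p ^ (Suc n - k) * qbinom p (Suc n) k + qbinom p (Suc n) (Suc k)"
        using k e by (simp add: algebra_simps)
      finally show ?thesis .
    next
      case False
      then show ?thesis using k Suc[of j] by (auto simp: qbinom_eq_0 not_le less_Suc_eq)
    qed
  qed
qed

text \<open>Since \<open>Suc k choose 2\<close> is \<open>k choose 2\<close> plus \<open>k\<close>,
  Pascal's rule turns each summand into a difference of consecutive values of \<open>U\<close>, and
  \<open>U\<close> vanishes at both ends.\<close>

lemma sum_alternating_qbinom:
  "(\<Sum>k\<le>n. (-1) ^ k * p ^ (k choose 2) * qbinom p n k) = (if n = 0 then 1 else 0)"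
proof (cases n)
  case (Suc m)
  define U where "U k = (case k of 0 \<Rightarrow> 0 | Suc j \<Rightarrow> (-1) ^ k * p ^ (k choose 2) * qbinom p m j)" for k
  have "(\<Sum>k\<le>n. (-1) ^ k * p ^ (k choose 2) * qbinom p n k) = (\<Sum>k\<le>n. U k - U (Suc k))"
  proof (rule sum.cong[OF refl])
    fix k
    show "(-1) ^ k * p ^ (k choose 2) * qbinom p n k = U k - U (Suc k)"
      by (cases k) (simp_all add: Suc U_def numeral_2_eq_2 power_add algebra_simps)
  qed
  also have "\<dots> = U 0 - U (Suc n)" by (rule sum_telescope)
  also have "\<dots> = 0" by (simp add: U_def Suc qbinom_eq_0)
  finally show ?thesis using Suc by simp
qed (simp add: numeral_2_eq_2)

definition qfact :: "'a::comm_ring_1 \<Rightarrow> nat \<Rightarrow> 'a" where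
  "qfact p n = (\<Prod>j=1..n. qint j p)"

lemma qfact_0 [simp]: "qfact p 0 = 1" and qfact_Suc: "qfact p (Suc n) = qint (Suc n) p * qfact p n"
  by (simp_all add: qfact_def mult.commute)

lemma qint_add: "qint (m + n) p = qint m p + p ^ m * qint n p"
  by (induction n) (simp_all add: qint_def power_add algebra_simps)

text \<open>Free of division, hence valid in every commutative ring. The induction step is Pascal's
  rule together with [k+1] + p^(k+1) [l+1] = [n+1] for n = k + l + 1.\<close>

lemma qbinom_qfact: "k \<le> n \<Longrightarrow> qbinom p n k * qfact p k * qfact p (n - k) = qfact p n"
proof (induction p n k rule: qbinom.induct)
  case (3 p n k)
  show ?case
  proof (cases "k = n")
    case False
    then obtain l where n: "n = k + Suc l"
      using 3(3) by (metis Suc_le_mono less_iff_Suc_add le_neq_implies_less add_Suc_right)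
    have 1: "qbinom p n k * qfact p k * qfact p (Suc l) = qfact p n"
      using 3(1) n by simp
    have 2: "qbinom p n (Suc k) * qfact p (Suc k) * qfact p l = qfact p n"
      using 3(2) n by simp
    have "qbinom p (Suc n) (Suc k) * qfact p (Suc k) * qfact p (Suc l)
       = qint (Suc k) p * (qbinom p n k * qfact p k * qfact p (Suc l))
         + p ^ Suc k * qint (Suc l) p * (qbinom p n (Suc k) * qfact p (Suc k) * qfact p l)"
      by (simp add: qfact_Suc algebra_simps)
    also have "\<dots> = (qint (Suc k) p + p ^ Suc k * qint (Suc l) p) * qfact p n"
      by (simp only: 1 2 distrib_right)
    also have "\<dots> = qint (Suc n) p * qfact p n"
      using qint_add[of "Suc k" "Suc l" p] n by simp
    finally show ?thesis using n by (simp add: qfact_Suc)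
  qed simp
qed auto

text \<open>The weight \<open>x\<close> allows two uses: \<open>x = 1\<close> for all derangements
  and \<open>x = q\<^sup>2\<close> for those with positive last letter. After substituting for
  \<open>c\<close>, the coefficient of \<open>a (N - s)\<close> contains the alternating sum, which
  is 0 unless \<open>s = 0\<close>. The nonzero q-integers allow q-factorials to be
  cancelled.\<close>

lemma qbinom_inversion:
  fixes a c :: "nat \<Rightarrow> 'a::field" and x p :: 'a
  assumes nz: "\<And>j. j \<in> {1..N} \<Longrightarrow> qint j p \<noteq> 0"
    and c: "\<And>M. M \<le> N \<Longrightarrow> c M = (\<Sum>j\<le>M. x ^ j * qbinom p M j * a (M - j))"
  shows "a N = (\<Sum>k\<le>N. (-x) ^ k * p ^ (k choose 2) * qbinom p N k * c (N - k))"
proof -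
  have fz: "qfact p k \<noteq> 0" if "k \<le> N" for k
    unfolding qfact_def using that nz by (subst prod_zero_iff) auto
  \<comment> \<open>Trinomial revision: both sides are the q-multinomial coefficient with parts k, s
    - k and N - s.\<close>
  have tri: "qbinom p N k * qbinom p (N - k) (s - k) = qbinom p N s * qbinom p s k"
    if "k \<le> s" "s \<le> N" for k s
  proof -
    have 1: "qbinom p N k * qfact p k * qfact p (N - k) = qfact p N"
      and 2: "qbinom p (N - k) (s - k) * qfact p (s - k) * qfact p (N - s) = qfact p (N - k)"
      and 3: "qbinom p N s * qfact p s * qfact p (N - s) = qfact p N"
      and 4: "qbinom p s k * qfact p k * qfact p (s - k) = qfact p s"
      using qbinom_qfact[of k N p] qbinom_qfact[of "s - k" "N - k" p] qbinom_qfact[of s N p]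
        qbinom_qfact[of k s p] that by auto
    have "qbinom p N k * qbinom p (N - k) (s - k) * (qfact p k * qfact p (s - k) * qfact p (N - s))
        = qbinom p N k * qfact p k * (qbinom p (N - k) (s - k) * qfact p (s - k) * qfact p (N - s))"
      by (simp only: mult_ac)
    also have "\<dots> = qfact p N" by (simp only: 1 2)
    also have "\<dots> = qbinom p N s * (qbinom p s k * qfact p k * qfact p (s - k)) * qfact p (N - s)"
      by (simp only: 3 4)
    also have "\<dots> = qbinom p N s * qbinom p s k * (qfact p k * qfact p (s - k) * qfact p (N - s))"
      by (simp only: mult_ac)
    finally show ?thesis using fz that by simp
  qed
  have "(\<Sum>k\<le>N. (-x) ^ k * p ^ (k choose 2) * qbinom p N k * c (N - k))
      = (\<Sum>k\<le>N. \<Sum>j\<le>N - k. (-x) ^ k * p ^ (k choose 2) * qbinom p N k *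
           (x ^ j * qbinom p (N - k) j * a (N - k - j)))"
    by (simp add: c sum_distrib_left)
  also have "\<dots> = (\<Sum>k\<le>N. \<Sum>s=k..N. (-x) ^ k * p ^ (k choose 2) * qbinom p N k *
           (x ^ (s - k) * qbinom p (N - k) (s - k) * a (N - s)))"
  proof (rule sum.cong[OF refl], goal_cases)
    case (1 k)
    show ?case
      by (rule sum.reindex_bij_witness[of _ "\<lambda>s. s - k" "\<lambda>j. k + j"]) (use 1 in auto)
  qed
  also have "\<dots> = (\<Sum>k\<le>N. \<Sum>s=k..N. x ^ s * qbinom p N s * a (N - s) *
           ((-1) ^ k * p ^ (k choose 2) * qbinom p s k))"
  proof (intro sum.cong refl, goal_cases)
    case (1 k s)
    have "(-x) ^ k * x ^ (s - k) = (-1) ^ k * x ^ s"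
      using 1 by (subst power_minus) (simp add: power_add[symmetric])
    then show ?case using tri[of k s] 1 
      by (smt (verit) atMost_iff atLeastAtMost_iff mult.assoc mult.left_commute mult.commute)
  qed
  also have "\<dots> = (\<Sum>s\<le>N. \<Sum>k\<le>s. x ^ s * qbinom p N s * a (N - s) *
           ((-1) ^ k * p ^ (k choose 2) * qbinom p s k))"
    by (subst (1 2) sum.Sigma; (simp; fail)?)
       (rule sum.reindex_bij_witness[of _ "\<lambda>(s, k). (k, s)" "\<lambda>(k, s). (s, k)"]; auto)
  also have "\<dots> = (\<Sum>s\<le>N. x ^ s * qbinom p N s * a (N - s) * (if s = 0 then 1 else 0))"
    by (simp only: sum_distrib_left[symmetric] sum_alternating_qbinom)
  also have "\<dots> = a N" by (simp add: if_distrib sum.delta' cong: if_cong)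
  finally show ?thesis by simp
qed

section \<open>Signed words with prescribed last letter\<close>

lemma prec_less_irrefl: "\<not> prec_less x x"
  and prec_less_trans: "prec_less x y \<Longrightarrow> prec_less y z \<Longrightarrow> prec_less x z"
  and prec_less_total: "x \<noteq> 0 \<Longrightarrow> y \<noteq> 0 \<Longrightarrow> x \<noteq> y \<Longrightarrow> prec_less x y \<or> prec_less y x"
  by (auto simp: prec_less_def)

text \<open>The rank of a letter counted from the top, where \<open>x\<close> need not belong to
  \<open>Y\<close>. It turns out to be the exponent that a prescribed last letter
  contributes.\<close>

definition above :: "int set \<Rightarrow> int \<Rightarrow> nat" where
  "above Y x = card {y \<in> Y. prec_less x y}"

lemma above_mono: "finite Y \<Longrightarrow> prec_less x y \<Longrightarrow> above Y y \<le> above Y x"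
  unfolding above_def by (intro card_mono) (auto intro: prec_less_trans)

lemma above_strict: "finite Y \<Longrightarrow> y \<in> Y \<Longrightarrow> prec_less x y \<Longrightarrow> above Y y < above Y x"
  unfolding above_def
  by (intro psubset_card_mono psubsetI)
     (use prec_less_irrefl in \<open>auto intro: prec_less_trans\<close>)

lemma bij_betw_above:
  assumes "finite Y" "0 \<notin> Y"
  shows "bij_betw (above Y) Y {..<card Y}"
proof -
  have inj: "inj_on (above Y) Y"
  proof (rule inj_onI, rule ccontr)
    fix x y assume "x \<in> Y" "y \<in> Y" "above Y x = above Y y" "x \<noteq> y"
    then show False
      using prec_less_total[of x y] above_strict[OF assms(1)] assms(2) by (metis nat_neq_iff)
  qed
  have "above Y x < card Y" if "x \<in> Y" for x
    unfolding above_def by (rule psubset_card_mono) (use that assms prec_less_irrefl in auto)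
  then have "above Y ` Y \<subseteq> {..<card Y}" by auto
  then have "above Y ` Y = {..<card Y}"
    by (intro card_subset_eq) (simp_all add: card_image[OF inj])
  with inj show ?thesis by (simp add: bij_betw_def)
qed

lemma above_less_iff:
  assumes "finite Y" "0 \<notin> Y" "x \<noteq> 0" "y \<in> Y"
  shows "above Y y < above Y x \<longleftrightarrow> prec_less x y"
proof
  assume "above Y y < above Y x"
  then show "prec_less x y"
    using assms prec_less_total[of x y] above_mono[of Y y x] by fastforce
qed (use assms above_strict in auto)

text \<open>Let t be \<open>above Y x\<close>. The letters above \<open>x\<close> have the ranks 0,
  ..., t - 1. Raising these by \<open>card Y\<close> moves them behind the remaining ranks, so the
  exponents fill the interval from t to t + \<open>card Y\<close> - 1.\<close>

lemma sum_above_shift: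
  fixes q :: "'a::comm_ring_1"
  assumes "finite Y" "0 \<notin> Y" "x \<noteq> 0"
  shows "(\<Sum>y\<in>Y. q ^ (above Y y + (if prec_less x y then card Y else 0)))
    = q ^ above Y x * qint (card Y) q"
proof -
  define N where "N = card Y"
  define t where "t = above Y x"
  have t: "t \<le> N" unfolding t_def N_def above_def using assms by (intro card_mono) auto
  have "(\<Sum>y\<in>Y. q ^ (above Y y + (if prec_less x y then card Y else 0)))
      = (\<Sum>y\<in>Y. q ^ (above Y y + (if above Y y < t then N else 0)))"
    using assms by (intro sum.cong) (simp_all add: above_less_iff t_def N_def)
  also have "\<dots> = (\<Sum>i<N. q ^ (i + (if i < t then N else 0)))"
    using sum.reindex_bij_betw[OF bij_betw_above[OF assms(1,2)]] by (simp add: N_def)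
  also have "\<dots> = (\<Sum>i<N. q ^ (t + i))"
    by (rule sum.reindex_bij_witness[of _ "\<lambda>i. if t + i < N then t + i else t + i - N"
            "\<lambda>i. if i < t then i + N - t else i - t"]) (use t in auto)
  also have "\<dots> = q ^ t * qint N q" by (simp add: qint_def sum_distrib_left power_add)
  finally show ?thesis by (simp add: t_def N_def)
qed

text \<open>An arbitrary set of absolute values is allowed because deleting the last letter of a
  signed permutation leaves one with a gap.\<close>

definition signed_words :: "int set \<Rightarrow> int list set" where
  "signed_words A = {w. distinct (map abs w) \<and> set (map abs w) = A}"

lemma signed_perms_eq: "signed_perms n = signed_words {1..int n}"
proof -
  have "length w = n" if "distinct (map abs w)" "set (map abs w) = {1..int n}" for w :: "int list"
    using distinct_card[OF that(1)] that(2) by simp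
  then show ?thesis by (auto simp: signed_perms_def signed_words_def)
qed

lemma abs_mem_signed: "\<bar>x\<bar> \<in> A \<Longrightarrow> x \<in> A \<union> uminus ` A" for x :: int
  by (metis UnI1 UnI2 abs_if image_eqI minus_minus)

lemma length_signed_words: "w \<in> signed_words A \<Longrightarrow> length w = card A"
  unfolding signed_words_def by (metis (mono_tags, lifting) distinct_card length_map mem_Collect_eq)

lemma finite_signed_words: "finite A \<Longrightarrow> finite (signed_words A)"
proof -
  assume A: "finite A"
  have "signed_words A \<subseteq> {w. set w \<subseteq> A \<union> uminus ` A \<and> length w = card A}"
  proof safe
    fix w x assume w: "w \<in> signed_words A" "x \<in> set w" "x \<notin> uminus ` A"
    then have "\<bar>x\<bar> \<in> A" by (auto simp: signed_words_def)
    with w(3) show "x \<in> A" using abs_mem_signed by blast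
  qed (rule length_signed_words)
  with finite_lists_length_eq[of "A \<union> uminus ` A"] A show ?thesis
    by (auto intro: finite_subset)
qed

lemma snoc_in_signed_words:
  "w @ [x] \<in> signed_words A \<longleftrightarrow> \<bar>x\<bar> \<in> A \<and> w \<in> signed_words (A - {\<bar>x\<bar>})"
  unfolding signed_words_def by (auto simp: rev_image_eqI)

lemma neg_snoc: "neg (w @ [x]) = neg w + (if x < 0 then 1 else 0)"
  by (simp add: neg_def)

lemma maj_prec_snoc:
  "maj_prec (w @ [x]) = maj_prec w + (if w \<noteq> [] \<and> prec_less x (last w) then length w else 0)"
proof (cases "w = []")
  case False
  then have "{1..<length (w @ [x])} = insert (length w) {1..<length w}" by (cases w) auto
  with False show ?thesis
    by (auto simp: maj_prec_def nth_append last_conv_nth intro!: sum.cong)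
qed (simp add: maj_prec_def)

lemma fmaj_snoc:
  "fmaj (w @ [x]) = fmaj w + (if w \<noteq> [] \<and> prec_less x (last w) then 2 * length w else 0)
     + (if x < 0 then 1 else 0)"
  by (simp add: fmaj_def neg_snoc maj_prec_snoc)

definition dbl_qfact :: "'a::comm_ring_1 \<Rightarrow> nat \<Rightarrow> 'a" where
  "dbl_qfact q n = (\<Prod>j=1..n. qint (2 * j) q)"

lemma dbl_qfact_0 [simp]: "dbl_qfact q 0 = 1"
  and dbl_qfact_Suc: "dbl_qfact q (Suc n) = qint (2 * Suc n) q * dbl_qfact q n"
  by (simp_all add: dbl_qfact_def mult.commute)

text \<open>Delete the last letter \<open>x\<close> and sum over the new last letter y. A descent
  from y to \<open>x\<close> adds twice the remaining length, which is exactly the number of signed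
  letters that remain. This is the shift in \<open>sum_above_shift\<close>, so each step contributes
  one factor \<open>qint (2 * m) q\<close>.\<close>

lemma sum_signed_words_last:
  fixes q :: "'a::comm_ring_1"
  assumes "finite A" "A \<subseteq> {1..}" "\<bar>x\<bar> \<in> A"
  shows "(\<Sum>w | w \<in> signed_words A \<and> last w = x. q ^ fmaj w)
    = q ^ above (A \<union> uminus ` A) x * dbl_qfact q (card A - 1)"
  using assms
proof (induction "card A" arbitrary: A x)
  case 0
  then show ?case by auto
next
  case (Suc m)
  define B where "B = A - {\<bar>x\<bar>}"
  define Y where "Y = B \<union> uminus ` B"
  have x0: "x \<noteq> 0" using Suc.prems by auto
  have B: "finite B" "B \<subseteq> {1..}" "card B = m" "A = insert \<bar>x\<bar> B" "\<bar>x\<bar> \<notin> B"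
    using Suc by (auto simp: B_def)
  have Y: "finite Y" "0 \<notin> Y" using B by (auto simp: Y_def)
  have cY: "card Y = 2 * m"
  proof -
    have "b \<noteq> - b'" if "b \<in> B" "b' \<in> B" for b b'
    proof -
      have "b \<ge> 1" "b' \<ge> 1" using that B(2) by auto
      then show ?thesis by linarith
    qed
    then have "B \<inter> uminus ` B = {}" by blast
    then show ?thesis
      unfolding Y_def using B by (subst card_Un_disjoint) (auto simp: card_image)
  qed
  have ne: "w \<noteq> []" if "w \<in> signed_words A" for w
    using length_signed_words[OF that] Suc(2) by auto
  \<comment> \<open>For negative \<open>x\<close> the letter \<open>- x\<close> lies above
    \<open>x\<close>, which accounts for the 1 that \<open>x\<close> adds to \<open>neg\<close>. For
    positive \<open>x\<close> it lies below and is not counted.\<close>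
  have ab: "above (A \<union> uminus ` A) x = above Y x + (if x < 0 then 1 else 0)"
  proof (cases "x < 0")
    case True
    have "{y \<in> A \<union> uminus ` A. prec_less x y} = insert (- x) {y \<in> Y. prec_less x y}"
      using True B(4) by (auto simp: Y_def prec_less_def)
    moreover have "- x \<notin> Y" using True B by (auto simp: Y_def)
    ultimately show ?thesis using True Y by (simp add: above_def)
  next
    case False
    then have "{y \<in> A \<union> uminus ` A. prec_less x y} = {y \<in> Y. prec_less x y}"
      using B(4) by (auto simp: Y_def prec_less_def)
    then show ?thesis using False by (simp add: above_def)
  qed
  have "(\<Sum>w | w \<in> signed_words A \<and> last w = x. q ^ fmaj w)
      = (\<Sum>w\<in>signed_words B. q ^ fmaj (w @ [x]))"
  proof (rule sum.reindex_bij_witness[of _ "\<lambda>w. w @ [x]" butlast])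
    fix w assume "w \<in> {w \<in> signed_words A. last w = x}"
    then show 1: "butlast w @ [x] = w" using ne by (metis (mono_tags, lifting) append_butlast_last_id mem_Collect_eq)
    then show "butlast w \<in> signed_words B" "q ^ fmaj (butlast w @ [x]) = q ^ fmaj w"
      using \<open>w \<in> _\<close> snoc_in_signed_words[of "butlast w" x A] by (auto simp: B_def)
  qed (use Suc.prems in \<open>auto simp: B_def snoc_in_signed_words\<close>)
  also have "\<dots> = q ^ above (A \<union> uminus ` A) x * dbl_qfact q m"
  \<comment> \<open>With \<open>m = 0\<close> nothing precedes \<open>x\<close>, so there is no
    previous last letter to sum over.\<close>
  proof (cases "m = 0")
    case True
    then have "B = {}" using B by auto
    then have "signed_words B = {[]}" by (auto simp: signed_words_def)
    moreover have "above Y x = 0" using \<open>B = {}\<close> by (simp add: Y_def above_def)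
    ultimately show ?thesis using True by (simp add: ab fmaj_def neg_def maj_prec_def)
  next
    case False
    have lw: "w \<noteq> []" "length w = m" "last w \<in> Y" if "w \<in> signed_words B" for w
    proof -
      show l: "length w = m" using length_signed_words[OF that] B by simp
      then show ne: "w \<noteq> []" using False by auto
      then have "\<bar>last w\<bar> \<in> B" using that by (auto simp: signed_words_def)
      then show "last w \<in> Y" unfolding Y_def by (rule abs_mem_signed)
    qed
    have "(\<Sum>w\<in>signed_words B. q ^ fmaj (w @ [x]))
      = (\<Sum>y\<in>Y. \<Sum>w | w \<in> signed_words B \<and> last w = y. q ^ fmaj (w @ [x]))"
      by (rule sum.group[symmetric]) (use finite_signed_words B Y lw in auto)
    also have "\<dots> = (\<Sum>y\<in>Y. q ^ ((if prec_less x y then card Y else 0) + (if x < 0 then 1 else 0)) *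
          (\<Sum>w | w \<in> signed_words B \<and> last w = y. q ^ fmaj w))"
      unfolding sum_distrib_left
      by (intro sum.cong refl) (use lw in \<open>auto simp: fmaj_snoc power_add cY mult_ac\<close>)
    also have "\<dots> = (\<Sum>y\<in>Y. q ^ ((if prec_less x y then card Y else 0) + (if x < 0 then 1 else 0)) *
          (q ^ above Y y * dbl_qfact q (m - 1)))"
    proof (intro sum.cong refl, goal_cases)
      case (1 y)
      then have "\<bar>y\<bar> \<in> B" using B(2) by (auto simp: Y_def)
      then show ?case using Suc(1)[of B y] B by (simp add: Y_def)
    qed
    also have "\<dots> = q ^ (if x < 0 then 1 else 0) * dbl_qfact q (m - 1) *
        (\<Sum>y\<in>Y. q ^ (above Y y + (if prec_less x y then card Y else 0)))"
      unfolding sum_distrib_left by (intro sum.cong refl) (simp add: power_add mult_ac)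
    also have "\<dots> = q ^ (above Y x + (if x < 0 then 1 else 0)) * (qint (2 * m) q * dbl_qfact q (m - 1))"
      unfolding sum_above_shift[OF Y x0] by (simp add: cY power_add mult_ac)
    also have "qint (2 * m) q * dbl_qfact q (m - 1) = dbl_qfact q m"
      using False by (cases m) (simp_all add: dbl_qfact_Suc)
    finally show ?thesis by (simp add: ab)
  qed
  also have "m = card A - 1" using Suc(2) by simp
  finally show ?case .
qed


lemma sum_signed_words_last_in:
  fixes q :: "'a::comm_ring_1"
  assumes A: "finite A" "A \<subseteq> {1..}" "A \<noteq> {}" and Z: "Z \<subseteq> A \<union> uminus ` A"
  shows "(\<Sum>w | w \<in> signed_words A \<and> last w \<in> Z. q ^ fmaj w)
    = (\<Sum>x\<in>Z. q ^ above (A \<union> uminus ` A) x) * dbl_qfact q (card A - 1)"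
proof -
  have "(\<Sum>w | w \<in> signed_words A \<and> last w \<in> Z. q ^ fmaj w)
      = (\<Sum>x\<in>Z. \<Sum>w | w \<in> {w \<in> signed_words A. last w \<in> Z} \<and> last w = x. q ^ fmaj w)"
    by (rule sum.group[symmetric])
       (use finite_signed_words A Z finite_subset[OF Z] in auto)
  also have "\<dots> = (\<Sum>x\<in>Z. \<Sum>w | w \<in> signed_words A \<and> last w = x. q ^ fmaj w)"
    by (intro sum.cong) auto
  also have "\<dots> = (\<Sum>x\<in>Z. q ^ above (A \<union> uminus ` A) x * dbl_qfact q (card A - 1))"
  proof (intro sum.cong refl sum_signed_words_last A)
    fix x assume "x \<in> Z"
    then have "x \<in> A \<union> uminus ` A" using Z by auto
    then show "\<bar>x\<bar> \<in> A" using A(2) by auto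
  qed
  finally show ?thesis by (simp add: sum_distrib_right)
qed

lemma sum_signed_perms:
  fixes q :: "'a::comm_ring_1"
  shows "(\<Sum>w\<in>signed_perms n. q ^ fmaj w) = dbl_qfact q n"
proof (cases n)
  case 0
  have "signed_perms 0 = {[]}" by (auto simp: signed_perms_def)
  then show ?thesis using 0 by (simp add: fmaj_def neg_def maj_prec_def)
next
  case (Suc m)
  define Y where "Y = {1..int n} \<union> uminus ` {1..int n}"
  have "{1..int n} \<inter> uminus ` {1..int n} = {}" by auto
  then have cY: "card Y = 2 * n"
    unfolding Y_def by (subst card_Un_disjoint) (auto simp: card_image)
  have "last w \<in> Y" if "w \<in> signed_perms n" for w
  proof -
    have "w \<noteq> []" using that Suc by (auto simp: signed_perms_def)
    then have "\<bar>last w\<bar> \<in> set (map abs w)" by simp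
    then have "\<bar>last w\<bar> \<in> {1..int n}" using that by (simp only: signed_perms_def mem_Collect_eq)
    then show ?thesis unfolding Y_def by (rule abs_mem_signed)
  qed
  then have "{w \<in> signed_words {1..int n}. last w \<in> Y} = signed_perms n"
    by (auto simp: signed_perms_eq)
  then have "(\<Sum>w\<in>signed_perms n. q ^ fmaj w)
      = (\<Sum>x\<in>Y. q ^ above Y x) * dbl_qfact q (n - 1)"
    using sum_signed_words_last_in[of "{1..int n}" Y q] Suc by (simp add: Y_def nat_add_distrib)
  also have "(\<Sum>x\<in>Y. q ^ above Y x) = qint (2 * n) q"
  proof -
    have "finite Y" "0 \<notin> Y" by (auto simp: Y_def)
    then show ?thesis
      using sum.reindex_bij_betw[OF bij_betw_above[of Y], of "\<lambda>i. q ^ i"] by (simp add: qint_def cY)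
  qed
  finally show ?thesis using Suc by (simp add: dbl_qfact_Suc)
qed

text \<open>The letter N + 1 is left out because in the last position it would be a fixed point. A
  letter x in the range has N + 1 - x letters above it, so the exponents run through 1, ...,
  N.\<close>

lemma sum_signed_perms_last_pos:
  fixes q :: "'a::comm_ring_1"
  shows "(\<Sum>w | w \<in> signed_perms (Suc N) \<and> last w \<in> {1..int N}. q ^ fmaj w)
    = q * qint N q * dbl_qfact q N"
proof -
  define A where "A = {1..int (Suc N)}"
  have ab: "above (A \<union> uminus ` A) (int x) = Suc N - x" if "x \<in> {1..N}" for x
  proof -
    have "{y \<in> A \<union> uminus ` A. prec_less (int x) y} = {int x<..int (Suc N)}"
      using that by (auto simp: A_def prec_less_def)
    then show ?thesis by (simp add: above_def)
  qed
  have "(\<Sum>w | w \<in> signed_perms (Suc N) \<and> last w \<in> {1..int N}. q ^ fmaj w)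
    = (\<Sum>x\<in>{1..int N}. q ^ above (A \<union> uminus ` A) x) * dbl_qfact q N"
    using sum_signed_words_last_in[of A "{1..int N}" q]
    by (simp add: signed_perms_eq A_def subset_iff nat_add_distrib del: of_nat_Suc)
  also have "(\<Sum>x\<in>{1..int N}. q ^ above (A \<union> uminus ` A) x) = (\<Sum>x\<in>{1..N}. q ^ (Suc N - x))"
  proof (rule sum.reindex_bij_witness[of _ int nat])
    fix x assume "x \<in> {1..int N}"
    then show "q ^ (Suc N - nat x) = q ^ above (A \<union> uminus ` A) x"
      using ab[of "nat x"] by (simp add: nat_le_iff le_nat_iff)
  qed auto
  also have "\<dots> = (\<Sum>i<N. q ^ Suc i)"
    by (rule sum.reindex_bij_witness[of _ "\<lambda>i. N - i" "\<lambda>x. N - x"]) (auto simp: Suc_diff_le)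
  also have "\<dots> = q * qint N q" by (simp add: qint_def sum_distrib_left)
  finally show ?thesis .
qed

section \<open>Shuffles with equal letters of intermediate size\<close>

definition ksubsets :: "nat \<Rightarrow> nat \<Rightarrow> nat set set" where
  "ksubsets n k = {F. F \<subseteq> {..<n} \<and> card F = k}"

lemma finite_ksubsets: "finite (ksubsets n k)"
  by (rule finite_subset[of _ "Pow {..<n}"]) (auto simp: ksubsets_def)

lemma ksubsetsD: "F \<in> ksubsets n k \<Longrightarrow> F \<subseteq> {..<n} \<and> finite F \<and> card F = k \<and> n \<notin> F"
  by (auto simp: ksubsets_def intro: finite_subset)

lemma card_compl_ksubsets: "F \<in> ksubsets n k \<Longrightarrow> card ({..<n} - F) = n - k"
  using ksubsetsD[of F n k] by (simp add: card_Diff_subset)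

lemma ksubsets_full: "ksubsets n n = {{..<n}}"
  using card_subset_eq[of "{..<n}"] by (auto simp: ksubsets_def)

lemma ksubsets_0: "ksubsets n 0 = {{}}"
  by (auto simp: ksubsets_def) (metis card_0_eq empty_iff finite_lessThan finite_subset)

text \<open>Equal letters are inserted into a base word: \<open>hi j\<close> says that letter \<open>j\<close> of the base word lies
  above the inserted letters (otherwise it lies below them), and \<open>ds j\<close> that the base word has a
  descent between the letters \<open>j - 1\<close> and \<open>j\<close>. A shuffle is given by the set \<open>F\<close> of positions of
  the inserted letters.\<close>

locale shuffle =
  fixes hi :: "nat \<Rightarrow> bool" and ds :: "nat \<Rightarrow> bool" and M :: nat
  assumes ascent: "0 < j \<Longrightarrow> j < M \<Longrightarrow> \<not> hi (j - 1) \<Longrightarrow> hi j \<Longrightarrow> \<not> ds j"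
    and descent: "0 < j \<Longrightarrow> j < M \<Longrightarrow> hi (j - 1) \<Longrightarrow> \<not> hi j \<Longrightarrow> ds j"
begin

text \<open>If position \<open>i\<close> holds a base letter, its index is
  \<open>card ({..<i} - F)\<close>. Two adjacent inserted letters never form a descent, since the
  fixed points they stand for increase.\<close>

definition shuffle_descent :: "nat set \<Rightarrow> nat \<Rightarrow> bool" where
  "shuffle_descent F i \<longleftrightarrow>
    (if i \<in> F then i - 1 \<notin> F \<and> hi (card ({..<i - 1} - F))
     else if i - 1 \<in> F then \<not> hi (card ({..<i} - F))
     else ds (card ({..<i} - F)))"

definition shuffle_maj :: "nat \<Rightarrow> nat set \<Rightarrow> nat" where
  "shuffle_maj n F = (\<Sum>i\<in>{1..<n}. if shuffle_descent F i then i else 0)"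

definition base_maj :: "nat \<Rightarrow> nat" where
  "base_maj m = (\<Sum>j\<in>{1..<m}. if ds j then j else 0)"

text \<open>The sum is split by the kind of the last position, because that decides whether an
  appended letter creates a descent.\<close>

definition end_in :: "'a::comm_ring_1 \<Rightarrow> nat \<Rightarrow> nat \<Rightarrow> 'a" where
  "end_in p n k = (\<Sum>F | F \<in> ksubsets n k \<and> n - 1 \<in> F. p ^ shuffle_maj n F)"

definition end_out :: "'a::comm_ring_1 \<Rightarrow> nat \<Rightarrow> nat \<Rightarrow> 'a" where
  "end_out p n k = (\<Sum>F | F \<in> ksubsets n k \<and> n - 1 \<notin> F. p ^ shuffle_maj n F)"

lemma end_in_plus_end_out: "end_in p n k + end_out p n k = (\<Sum>F\<in>ksubsets n k. p ^ shuffle_maj n F)"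
proof -
  have "ksubsets n k = {F. F \<in> ksubsets n k \<and> n - 1 \<in> F} \<union> {F. F \<in> ksubsets n k \<and> n - 1 \<notin> F}" by auto
  then show ?thesis
    unfolding end_in_def end_out_def by (subst (3) \<open>ksubsets n k = _\<close>, subst sum.union_disjoint) (auto simp: finite_ksubsets)
qed

lemma shuffle_maj_Suc: "shuffle_maj (Suc n) F = shuffle_maj n F + (if shuffle_descent F n then n else 0)"
  by (cases n) (simp_all add: shuffle_maj_def)

lemma shuffle_maj_insert: "shuffle_maj n (insert n F) = shuffle_maj n F"
proof -
  have "shuffle_descent (insert n F) i = shuffle_descent F i" if "i < n" for i
  proof -
    have "{..<i} - insert n F = {..<i} - F" "{..<i - 1} - insert n F = {..<i - 1} - F"
      using that by auto
    moreover have "i \<noteq> n" "i - 1 \<noteq> n" using that by auto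
    ultimately show ?thesis by (simp add: shuffle_descent_def)
  qed
  then show ?thesis by (simp add: shuffle_maj_def)
qed

text \<open>An appended inserted letter creates a descent exactly when a high base letter precedes
  it. With k inserted letters among n positions, that base letter has index n - k - 1.\<close>

lemma end_in_Suc:
  "end_in p (Suc n) (Suc k) = end_in p n k + p ^ (if hi (n - k - 1) then n else 0) * end_out p n k"
proof -
  have d: "shuffle_descent (insert n F) n \<longleftrightarrow> n - 1 \<notin> F \<and> hi (n - k - 1)"
    if F: "F \<in> ksubsets n k" and n: "0 < n" for F
  proof (cases "n - 1 \<in> F")
    case True
    then show ?thesis by (simp add: shuffle_descent_def)
  next
    case False
    have nn: "n - 1 \<noteq> n" using n by simp
    have "{..<n - 1} - insert n F = ({..<n} - F) - {n - 1}" using n by auto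
    moreover have "n - 1 \<in> {..<n} - F" using n False by simp
    ultimately have c: "card ({..<n - 1} - insert n F) = n - k - 1"
      by (metis F card_Diff_singleton card_compl_ksubsets)
    show ?thesis unfolding shuffle_descent_def c using False nn by simp
  qed
  have "end_in p (Suc n) (Suc k) = (\<Sum>F\<in>ksubsets n k. p ^ shuffle_maj (Suc n) (insert n F))"
    unfolding end_in_def
  proof (rule sum.reindex_bij_witness[of _ "insert n" "\<lambda>F. F - {n}"], goal_cases)
    case (1 F)
    then show ?case by (simp add: insert_absorb)
  next
    case (2 F)
    then have "F \<subseteq> {..<Suc n}" "card F = Suc k" "n \<in> F" by (simp_all add: ksubsets_def)
    moreover from this have "F - {n} \<subseteq> {..<n}" by (auto simp: less_Suc_eq)
    ultimately show ?case by (simp add: ksubsets_def)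
  next
    case (3 F)
    then show ?case using ksubsetsD[of F n k] by blast
  next
    case (4 F)
    then have "F \<subseteq> {..<n}" "card F = k" "finite F" "n \<notin> F" using ksubsetsD[of F n k] by simp_all
    moreover from this have "insert n F \<subseteq> {..<Suc n}" by (auto simp: less_Suc_eq)
    ultimately show ?case by (simp add: ksubsets_def)
  next
    case (5 F)
    then show ?case by (simp add: insert_absorb)
  qed
  also have "\<dots> = (\<Sum>F\<in>ksubsets n k. p ^ shuffle_maj n F * p ^ (if n - 1 \<notin> F \<and> hi (n - k - 1) then n else 0))"
    by (intro sum.cong refl) (cases "n = 0"; simp add: shuffle_maj_Suc shuffle_maj_insert d power_add)
  also have "\<dots> = (\<Sum>F\<in>ksubsets n k. (if n - 1 \<in> F then p ^ shuffle_maj n F else 0)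
      + p ^ (if hi (n - k - 1) then n else 0) * (if n - 1 \<notin> F then p ^ shuffle_maj n F else 0))"
    by (rule sum.cong) auto
  also have "\<dots> = end_in p n k + p ^ (if hi (n - k - 1) then n else 0) * end_out p n k"
    unfolding end_in_def end_out_def sum.distrib sum_distrib_left[symmetric]
    by (simp only: sum.inter_filter[OF finite_ksubsets])
  finally show ?thesis .
qed

text \<open>The appended letter is the base letter of index n - k. After an inserted letter it
  creates a descent iff it is low, after a base letter iff \<open>ds\<close> says so.\<close>

lemma end_out_Suc:
  "end_out p (Suc n) k = p ^ (if hi (n - k) then 0 else n) * end_in p n k
     + p ^ (if ds (n - k) then n else 0) * end_out p n k"
proof -
  have d: "shuffle_descent F n \<longleftrightarrow> (if n - 1 \<in> F then \<not> hi (n - k) else ds (n - k))"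
    if "F \<in> ksubsets n k" for F
    using that card_compl_ksubsets[OF that] ksubsetsD[OF that] by (auto simp: shuffle_descent_def)
  have "end_out p (Suc n) k = (\<Sum>F\<in>ksubsets n k. p ^ shuffle_maj (Suc n) F)"
    unfolding end_out_def by (rule sum.cong) (auto simp: ksubsets_def less_Suc_eq subset_iff)
  also have "\<dots> = (\<Sum>F\<in>ksubsets n k. p ^ (if hi (n - k) then 0 else n) * (if n - 1 \<in> F then p ^ shuffle_maj n F else 0)
      + p ^ (if ds (n - k) then n else 0) * (if n - 1 \<notin> F then p ^ shuffle_maj n F else 0))"
    by (intro sum.cong) (auto simp: shuffle_maj_Suc d power_add)
  also have "\<dots> = p ^ (if hi (n - k) then 0 else n) * end_in p n k
     + p ^ (if ds (n - k) then n else 0) * end_out p n k"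
    unfolding end_in_def end_out_def sum.distrib sum_distrib_left[symmetric]
    by (simp only: sum.inter_filter[OF finite_ksubsets])
  finally show ?thesis .
qed

lemma end_in_0 [simp]: "end_in p n 0 = 0" 
proof -
  have "{F. F \<in> ksubsets n 0 \<and> n - 1 \<in> F} = {}" by (auto simp: ksubsets_0)
  then show ?thesis by (simp only: end_in_def sum.empty)
qed

lemma end_out_full: "end_out p n n = (if n = 0 then 1 else 0)"
proof -
  have "{F. F \<in> ksubsets n n \<and> n - 1 \<notin> F} = (if n = 0 then {{}} else {})" by (auto simp: ksubsets_full)
  then show ?thesis by (simp add: end_out_def shuffle_maj_def)
qed

lemma end_in_full: "0 < n \<Longrightarrow> end_in p n n = 1"
proof (induction n)
  case (Suc n)
  then show ?case by (cases n) (simp_all add: end_in_Suc end_out_full)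
qed simp

lemma base_maj_Suc: "base_maj (Suc m) = base_maj m + (if ds m then m else 0)"
  by (cases m) (simp_all add: base_maj_def)

text \<open>Both closed forms are proved together by induction on the length of the shuffled word,
  since each recurrence mixes the two sums. The extra exponents record what the last base letter
  costs: a low one contributes k to \<open>end_out\<close>, a high one contributes m to
  \<open>end_in\<close>.\<close>

lemma end_out_end_in_eq:
  assumes "0 < m" "m \<le> M"
  shows "end_out p (m + k) k = p ^ (base_maj m + (if hi (m - 1) then 0 else k)) * qbinom p (m + k - 1) k
    \<and> end_in p (m + k) k = (if k = 0 then 0 else
        p ^ (base_maj m + (if hi (m - 1) then m else 0)) * qbinom p (m + k - 1) (k - 1))"
  using assms
proof (induction "m + k" arbitrary: m k)
  case (Suc n)
  have end_out: "end_out p (m + k) k = p ^ (base_maj m + (if hi (m - 1) then 0 else k)) * qbinom p (m + k - 1) k"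
  \<comment> \<open>Removing the only base letter leaves inserted letters alone, where the closed
    forms do not apply; that word is covered by \<open>end_in_full\<close>.\<close>
  proof (cases "m = 1")
    case True
    then have "n = k" using Suc(2) by simp
    then show ?thesis using True
      by (cases "k = 0") (simp_all add: end_out_Suc end_out_full end_in_full base_maj_def)
  next
    case False
    define l where "l = m - 2"
    have m: "m = Suc (Suc l)" using False Suc.prems by (simp add: l_def)
    then have n: "n = Suc l + k" using Suc(2) by simp
    have IH: "end_out p (Suc l + k) k = p ^ (base_maj (Suc l) + (if hi l then 0 else k)) * qbinom p (l + k) k"
      "end_in p (Suc l + k) k = (if k = 0 then 0 else
        p ^ (base_maj (Suc l) + (if hi l then Suc l else 0)) * qbinom p (l + k) (k - 1))"
      using Suc(1)[of "Suc l" k] n m Suc.prems by auto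
    have R: "end_out p (m + k) k = p ^ (if hi (Suc l) then 0 else Suc l + k) * end_in p (Suc l + k) k
       + p ^ (if ds (Suc l) then Suc l + k else 0) * end_out p (Suc l + k) k"
      using end_out_Suc[of p "Suc l + k" k] m by simp
    have b: "base_maj m = base_maj (Suc l) + (if ds (Suc l) then Suc l else 0)"
      unfolding m by (rule base_maj_Suc)
    \<comment> \<open>A change between low and high fixes \<open>ds\<close>, so six cases remain. In
      each of them the recurrence \<open>R\<close> becomes a common power of \<open>p\<close> times
      one of the two Pascal rules \<open>Q\<close> and \<open>Q'\<close>.\<close>
    have asc: "\<not> hi l \<Longrightarrow> hi (Suc l) \<Longrightarrow> \<not> ds (Suc l)"
      and descent_at: "hi l \<Longrightarrow> \<not> hi (Suc l) \<Longrightarrow> ds (Suc l)"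
      using ascent[of "Suc l"] descent[of "Suc l"] m Suc.prems by auto
    have Q: "qbinom p (Suc l + k) k = (if k = 0 then 0 else qbinom p (l + k) (k - 1)) + p ^ k * qbinom p (l + k) k"
      by (cases k) auto
    have Q': "qbinom p (Suc l + k) k = (if k = 0 then 0 else p ^ Suc l * qbinom p (l + k) (k - 1)) + qbinom p (l + k) k"
      by (cases k) (auto simp del: qbinom.simps(3) simp: qbinom_Suc_Suc')
    have mk: "m + k - 1 = Suc l + k" "m - 1 = Suc l" using m by simp_all
    show ?thesis
    proof (cases "hi l")
      case hl: True
      show ?thesis
      proof (cases "hi (Suc l)")
        case hs: True
        show ?thesis
        proof (cases "ds (Suc l)")
          case True
          with hl hs show ?thesis unfolding R IH b mk Q by (simp add: power_add algebra_simps)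
        next
          case False
          with hl hs show ?thesis unfolding R IH b mk Q' by (simp add: power_add algebra_simps)
        qed
      next
        case False
        with hl descent_at show ?thesis unfolding R IH b mk Q' by (simp add: power_add algebra_simps)
      qed
    next
      case hl: False
      show ?thesis
      proof (cases "hi (Suc l)")
        case True
        with hl asc show ?thesis unfolding R IH b mk Q by (simp add: power_add algebra_simps)
      next
        case hs: False
        show ?thesis
        proof (cases "ds (Suc l)")
          case True
          with hl hs show ?thesis unfolding R IH b mk Q by (simp add: power_add algebra_simps)
        next
          case False
          with hl hs show ?thesis unfolding R IH b mk Q' by (simp add: power_add algebra_simps)
        qed
      qed
    qed
  qed
  have end_in: "end_in p (m + k) k = (if k = 0 then 0 else
        p ^ (base_maj m + (if hi (m - 1) then m else 0)) * qbinom p (m + k - 1) (k - 1))"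
  proof (cases k)
    case k: (Suc j)
    have IH: "end_out p (m + j) j = p ^ (base_maj m + (if hi (m - 1) then 0 else j)) * qbinom p (m + j - 1) j"
      "end_in p (m + j) j = (if j = 0 then 0 else
        p ^ (base_maj m + (if hi (m - 1) then m else 0)) * qbinom p (m + j - 1) (j - 1))"
      using Suc(1)[of m j] k Suc by auto
    have R: "end_in p (m + k) k = end_in p (m + j) j + p ^ (if hi (m - 1) then m + j else 0) * end_out p (m + j) j"
      using end_in_Suc[of p "m + j" j] k by simp
    have Q: "qbinom p (m + j) j = (if j = 0 then 0 else qbinom p (m + j - 1) (j - 1)) + p ^ j * qbinom p (m + j - 1) j"
      using Suc.prems by (cases j; cases m) auto
    have mk: "m + k - 1 = m + j" "k - 1 = j" using k by simp_all
    show ?thesis unfolding R IH mk Q using k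
      by (cases "j = 0"; cases "hi (m - 1)") (simp_all add: power_add algebra_simps)
  qed simp
  from end_out end_in show ?case ..
qed simp

text \<open>For a low last base letter the exponents of \<open>end_in\<close> and
  \<open>end_out\<close> differ by k, so the two closed forms are the two terms of Pascal's
  rule.\<close>

lemma sum_shuffle_maj:
  assumes "k \<le> n" "n - k \<le> M" "n = k \<or> \<not> hi (n - k - 1)"
  shows "(\<Sum>F\<in>ksubsets n k. p ^ shuffle_maj n F) = p ^ base_maj (n - k) * qbinom p n k"
proof (cases "n = k")
  case True
  then show ?thesis
    by (cases "n = 0") (simp_all add: end_in_plus_end_out[symmetric] end_in_full end_out_full base_maj_def)
next
  case False
  define m where "m = n - k"
  have m: "0 < m" "m \<le> M" "n = m + k" "\<not> hi (m - 1)" using assms False by (auto simp: m_def)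
  have "qbinom p n k = (if k = 0 then 0 else qbinom p (n - 1) (k - 1)) + p ^ k * qbinom p (n - 1) k"
    using m by (cases k; cases m) auto
  then show ?thesis
    using end_out_end_in_eq[OF m(1,2), of p k] m
    by (simp add: end_in_plus_end_out[symmetric] power_add algebra_simps)
qed

end

section \<open>Inserting fixed points into a derangement\<close>

definition B_derangements :: "nat \<Rightarrow> int list set" where
  "B_derangements n = {w \<in> signed_perms n. \<forall>i<n. w ! i \<noteq> int (i + 1)}"

lemma signed_perms_iff:
  "w \<in> signed_perms n \<longleftrightarrow>
    length w = n \<and> inj_on (\<lambda>i. \<bar>w ! i\<bar>) {..<n} \<and> (\<forall>i<n. \<bar>w ! i\<bar> \<in> {1..int n})"
proof (intro iffI conjI; (elim conjE)?)
  assume w: "w \<in> signed_perms n"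
  then show "length w = n" by (simp add: signed_perms_def)
  with w show "inj_on (\<lambda>i. \<bar>w ! i\<bar>) {..<n}"
    by (auto simp: signed_perms_def distinct_conv_nth inj_on_def)
  have "\<bar>w ! i\<bar> \<in> set (map abs w)" if "i < n" for i
    using that \<open>length w = n\<close> by simp
  with w show "\<forall>i<n. \<bar>w ! i\<bar> \<in> {1..int n}" by (simp add: signed_perms_def)
next
  assume l: "length w = n" and inj: "inj_on (\<lambda>i. \<bar>w ! i\<bar>) {..<n}"
    and r: "\<forall>i<n. \<bar>w ! i\<bar> \<in> {1..int n}"
  have d: "distinct (map abs w)" using l inj by (auto simp: distinct_conv_nth inj_on_def)
  have "set (map abs w) \<subseteq> {1..int n}"
    using l r by (auto simp: in_set_conv_nth)
  moreover have "card (set (map abs w)) = card {1..int n}"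
    using distinct_card[OF d] l by simp
  ultimately have "set (map abs w) = {1..int n}" by (intro card_subset_eq) simp_all
  then show "w \<in> signed_perms n" using l d by (simp add: signed_perms_def)
qed

lemma B_derangementsD:
  assumes "w \<in> B_derangements n"
  shows "length w = n" "w \<in> signed_perms n"
    and "i < n \<Longrightarrow> w ! i \<noteq> 0" "i < n \<Longrightarrow> \<bar>w ! i\<bar> \<le> int n" "i < n \<Longrightarrow> w ! i \<noteq> int i + 1"
  using assms by (auto simp: B_derangements_def signed_perms_iff)

text \<open>Plays the role of \<open>hi\<close>: a letter of a derangement that exceeds its position
  lies above a fixed point inserted next to it, any other letter lies below. Negative letters thus
  count as low.\<close>

definition excedance :: "int list \<Rightarrow> nat \<Rightarrow> bool" where "excedance w j \<longleftrightarrow> int j + 1 < w ! j"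

definition descent_at :: "int list \<Rightarrow> nat \<Rightarrow> bool" where "descent_at w j \<longleftrightarrow> prec_less (w ! j) (w ! (j - 1))"

text \<open>Count positions from 1. A letter below its position j followed by a letter above j + 1
  forms an ascent; a letter above j followed by one below j + 1 forms a descent. A derangement
  excludes equality.\<close>

lemma shuffle_B_derangement:
  assumes w: "w \<in> B_derangements m"
  shows "shuffle (excedance w) (descent_at w) m"
proof
  fix j assume j: "0 < j" "j < m"
  have a: "w ! (j - 1) \<noteq> int j" using B_derangementsD(5)[OF w, of "j - 1"] j by simp
  show "\<not> descent_at w j" if "\<not> excedance w (j - 1)" "excedance w j" using that j a by (auto simp: prec_less_def excedance_def descent_at_def)
  show "descent_at w j" if "excedance w (j - 1)" "\<not> excedance w j"
    using that j B_derangementsD(3,5)[OF w j(2)] by (auto simp: prec_less_def excedance_def descent_at_def)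
qed

lemma base_maj_eq_maj_prec:
  assumes w: "w \<in> B_derangements m"
  shows "shuffle.base_maj (descent_at w) m = maj_prec w"
proof -
  interpret shuffle "excedance w" "descent_at w" m by (rule shuffle_B_derangement[OF w])
  show ?thesis unfolding base_maj_def maj_prec_def descent_at_def by (simp only: B_derangementsD(1)[OF w])
qed

text \<open>Positions are counted from 0 and letters from 1, hence the shifts by 1 in \<open>lift\<close>.\<close>

locale fixed_positions =
  fixes n :: nat and F :: "nat set"
  assumes F: "F \<subseteq> {..<n}"
begin

definition m :: nat where "m = n - card F"

definition rank :: "nat \<Rightarrow> nat" where "rank i = card ({..<i} - F)"

definition pos :: "nat \<Rightarrow> nat" where "pos = inv_into ({..<n} - F) rank"

definition lift :: "int \<Rightarrow> int" where "lift x = sgn x * (int (pos (nat \<bar>x\<bar> - 1)) + 1)"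

definition unlift :: "int \<Rightarrow> int" where "unlift y = sgn y * (int (rank (nat \<bar>y\<bar> - 1)) + 1)"

definition insert_fixed :: "int list \<Rightarrow> int list" where
  "insert_fixed w = map (\<lambda>i. if i \<in> F then int i + 1 else lift (w ! rank i)) [0..<n]"

definition remove_fixed :: "int list \<Rightarrow> int list" where
  "remove_fixed w = map (\<lambda>j. unlift (w ! pos j)) [0..<m]"

lemma rank_Suc: "rank (Suc i) = rank i + (if i \<in> F then 0 else 1)"
proof -
  have "{..<Suc i} - F = (if i \<in> F then {..<i} - F else insert i ({..<i} - F))"
    by (auto simp: less_Suc_eq)
  then show ?thesis by (simp add: rank_def)
qed

lemma rank_mono: "i \<le> i' \<Longrightarrow> rank i \<le> rank i'"
  unfolding rank_def by (intro card_mono) auto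

lemma rank_strict_mono: "i \<notin> F \<Longrightarrow> i < i' \<Longrightarrow> rank i < rank i'"
  using rank_mono[of "Suc i" i'] by (simp add: rank_Suc)

lemma rank_n: "rank n = m"
  using F by (simp add: rank_def m_def card_Diff_subset finite_subset)

lemma rank_less_iff: "i \<notin> F \<Longrightarrow> i' \<notin> F \<Longrightarrow> rank i < rank i' \<longleftrightarrow> i < i'"
  by (metis rank_strict_mono less_asym linorder_neqE_nat)

lemma bij_rank: "bij_betw rank ({..<n} - F) {..<m}"
proof -
  have inj: "inj_on rank ({..<n} - F)"
    by (rule inj_onI) (metis DiffD2 less_irrefl linorder_neqE_nat rank_strict_mono)
  have "rank ` ({..<n} - F) \<subseteq> {..<m}" using rank_strict_mono[of _ n] by (auto simp: rank_n)
  moreover have "card (rank ` ({..<n} - F)) = m"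
    using card_image[OF inj] rank_n by (simp add: rank_def)
  ultimately have "rank ` ({..<n} - F) = {..<m}" by (intro card_subset_eq) simp_all
  then show ?thesis using inj by (simp add: bij_betw_def)
qed

lemma rank_less: "i < n \<Longrightarrow> i \<notin> F \<Longrightarrow> rank i < m"
  using bij_rank by (auto simp: bij_betw_def)

lemma pos: "j < m \<Longrightarrow> pos j < n" "j < m \<Longrightarrow> pos j \<notin> F" "j < m \<Longrightarrow> rank (pos j) = j"
  and pos_rank: "i < n \<Longrightarrow> i \<notin> F \<Longrightarrow> pos (rank i) = i"
proof -
  show "j < m \<Longrightarrow> rank (pos j) = j"
    unfolding pos_def by (rule bij_betw_inv_into_right[OF bij_rank]) simp
  have "j < m \<Longrightarrow> pos j \<in> {..<n} - F"
    unfolding pos_def using bij_rank by (intro inv_into_into) (auto simp: bij_betw_def)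
  then show "j < m \<Longrightarrow> pos j < n" "j < m \<Longrightarrow> pos j \<notin> F" by auto
  show "i < n \<Longrightarrow> i \<notin> F \<Longrightarrow> pos (rank i) = i"
    unfolding pos_def by (rule bij_betw_inv_into_left[OF bij_rank]) simp
qed

lemma pos_less_iff: "j < m \<Longrightarrow> j' < m \<Longrightarrow> pos j < pos j' \<longleftrightarrow> j < j'"
  using rank_less_iff[of "pos j" "pos j'"] pos by simp

lemma lift_cases:
  assumes "x \<noteq> 0" "\<bar>x\<bar> \<le> int m"
  obtains j where "j < m" "x = int j + 1" "lift x = int (pos j) + 1"
  | j where "j < m" "x = - (int j + 1)" "lift x = - (int (pos j) + 1)"
proof (cases "x > 0")
  case True
  show ?thesis
    by (rule that(1)[of "nat x - 1"]) (use True assms in \<open>auto simp: lift_def\<close>)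
next
  case False
  show ?thesis
    by (rule that(2)[of "nat (- x) - 1"]) (use False assms in \<open>auto simp: lift_def\<close>)
qed

lemma unlift_lift: "x \<noteq> 0 \<Longrightarrow> \<bar>x\<bar> \<le> int m \<Longrightarrow> unlift (lift x) = x"
  by (erule (1) lift_cases) (auto simp: unlift_def pos nat_add_distrib)

lemma lift_unlift:
  assumes "y \<noteq> 0" "\<bar>y\<bar> \<le> int n" "nat \<bar>y\<bar> - 1 \<notin> F"
  shows "lift (unlift y) = y" "unlift y \<noteq> 0" "\<bar>unlift y\<bar> \<le> int m"
proof -
  define i where "i = nat \<bar>y\<bar> - 1"
  have i: "i < n" "i \<notin> F" "\<bar>y\<bar> = int i + 1" using assms by (auto simp: i_def)
  have u: "unlift y = sgn y * (int (rank i) + 1)" by (simp add: unlift_def i_def)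
  then show "unlift y \<noteq> 0" using assms by (simp add: sgn_if)
  show "\<bar>unlift y\<bar> \<le> int m" using rank_less[OF i(1,2)] assms u by (auto simp: sgn_if)
  show "lift (unlift y) = y"
    using u i pos_rank[OF i(1,2)] assms(1)
    by (cases "y > 0") (auto simp: lift_def sgn_if nat_add_distrib)
qed

lemma prec_less_lift:
  assumes "x \<noteq> 0" "\<bar>x\<bar> \<le> int m" "y \<noteq> 0" "\<bar>y\<bar> \<le> int m"
  shows "prec_less (lift x) (lift y) \<longleftrightarrow> prec_less x y"
  using assms(1,2)
proof (cases rule: lift_cases)
  case x: (1 j)
  show ?thesis using assms(3,4)
  proof (cases rule: lift_cases)
    case (1 k)
    then show ?thesis using x pos_less_iff[of j k] pos_less_iff[of k j]
      by (cases j k rule: linorder_cases) (simp_all add: prec_less_def)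
  next
    case (2 k)
    then show ?thesis using x pos_less_iff[of j k] pos_less_iff[of k j]
      by (cases j k rule: linorder_cases) (simp_all add: prec_less_def)
  qed
next
  case x: (2 j)
  show ?thesis using assms(3,4)
  proof (cases rule: lift_cases)
    case (1 k)
    then show ?thesis using x pos_less_iff[of j k] pos_less_iff[of k j]
      by (cases j k rule: linorder_cases) (simp_all add: prec_less_def)
  next
    case (2 k)
    then show ?thesis using x pos_less_iff[of j k] pos_less_iff[of k j]
      by (cases j k rule: linorder_cases) (simp_all add: prec_less_def)
  qed
qed

text \<open>Positions and absolute values are relabelled by the same increasing map
  \<open>pos\<close>, so a letter keeps its relation to its position. Negative letters lie below
  every position on both sides.\<close>

lemma lift_less_pos_iff:
  assumes "x \<noteq> 0" "\<bar>x\<bar> \<le> int m" "i < n" "i \<notin> F"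
  shows "lift x < int i + 1 \<longleftrightarrow> x < int (rank i) + 1" "int i + 1 < lift x \<longleftrightarrow> int (rank i) + 1 < x"
proof -
  have i: "rank i < m" "pos (rank i) = i" using rank_less pos_rank assms by auto
  have "(lift x < int i + 1 \<longleftrightarrow> x < int (rank i) + 1) \<and> (int i + 1 < lift x \<longleftrightarrow> int (rank i) + 1 < x)"
    using assms(1,2)
  proof (cases rule: lift_cases)
    case (1 j)
    then show ?thesis using pos_less_iff[of j "rank i"] pos_less_iff[of "rank i" j] i
      by (cases j "rank i" rule: linorder_cases) simp_all
  qed simp
  then show "lift x < int i + 1 \<longleftrightarrow> x < int (rank i) + 1" "int i + 1 < lift x \<longleftrightarrow> int (rank i) + 1 < x"
    by blast+
qed

lemma lift_neq:
  assumes "x \<noteq> 0" "\<bar>x\<bar> \<le> int m" "i \<in> F"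
  shows "\<bar>lift x\<bar> \<noteq> int i + 1"
  using assms(1,2) by (cases rule: lift_cases) (use pos(2) assms(3) in auto)

lemma lift_neg_iff: "x \<noteq> 0 \<Longrightarrow> \<bar>x\<bar> \<le> int m \<Longrightarrow> lift x < 0 \<longleftrightarrow> x < 0"
  by (erule (1) lift_cases) auto

lemma lift_range: "x \<noteq> 0 \<Longrightarrow> \<bar>x\<bar> \<le> int m \<Longrightarrow> \<bar>lift x\<bar> \<in> {1..int n}"
  by (erule (1) lift_cases) (use pos(1) in force)+

lemma abs_lift_eq_iff:
  assumes "x \<noteq> 0" "\<bar>x\<bar> \<le> int m" "y \<noteq> 0" "\<bar>y\<bar> \<le> int m" "\<bar>lift x\<bar> = \<bar>lift y\<bar>"
  shows "\<bar>x\<bar> = \<bar>y\<bar>"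
proof -
  have *: "\<exists>j<m. \<bar>x\<bar> = int j + 1 \<and> \<bar>lift x\<bar> = int (pos j) + 1" if "x \<noteq> 0" "\<bar>x\<bar> \<le> int m" for x
    using that by (cases rule: lift_cases) auto
  show ?thesis using *[OF assms(1,2)] *[OF assms(3,4)] assms(5) pos(3) by auto metis
qed

lemma length_insert_fixed: "length (insert_fixed w) = n"
  by (simp add: insert_fixed_def)

context
  fixes w assumes w: "w \<in> B_derangements m"
begin

lemma letter: "i < n \<Longrightarrow> i \<notin> F \<Longrightarrow> w ! rank i \<noteq> 0" "i < n \<Longrightarrow> i \<notin> F \<Longrightarrow> \<bar>w ! rank i\<bar> \<le> int m"
  using B_derangementsD[OF w] rank_less by auto

lemma insert_fixed_nth:
  "i < n \<Longrightarrow> insert_fixed w ! i = (if i \<in> F then int i + 1 else lift (w ! rank i))"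
  by (simp add: insert_fixed_def)

lemma insert_fixed_signed_perms: "insert_fixed w \<in> signed_perms n"
  unfolding signed_perms_iff
proof (intro conjI allI impI)
  show "length (insert_fixed w) = n" by (simp add: insert_fixed_def)
  show "\<bar>insert_fixed w ! i\<bar> \<in> {1..int n}" if "i < n" for i
    using that lift_range[OF letter[of i]] by (auto simp: insert_fixed_nth)
  show "inj_on (\<lambda>i. \<bar>insert_fixed w ! i\<bar>) {..<n}"
  proof (rule inj_onI)
    fix i j assume ij: "i \<in> {..<n}" "j \<in> {..<n}" and eq: "\<bar>insert_fixed w ! i\<bar> = \<bar>insert_fixed w ! j\<bar>"
    consider "i \<in> F" "j \<in> F" | "i \<in> F" "j \<notin> F" | "i \<notin> F" "j \<in> F" | "i \<notin> F" "j \<notin> F" by blast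
    then show "i = j"
    proof cases
      case 1
      then show ?thesis using eq ij by (simp add: insert_fixed_nth)
    next
      case 2
      then show ?thesis using eq ij lift_neq[OF letter[of j] 2(1)] by (simp add: insert_fixed_nth)
    next
      case 3
      then show ?thesis using eq ij lift_neq[OF letter[of i] 3(2)] by (simp add: insert_fixed_nth)
    next
      case 4
      have "\<bar>w ! rank i\<bar> = \<bar>w ! rank j\<bar>"
        using abs_lift_eq_iff[OF letter[of i] letter[of j]] eq ij 4 by (simp add: insert_fixed_nth)
      moreover have "inj_on (\<lambda>i. \<bar>w ! i\<bar>) {..<m}" using B_derangementsD(2)[OF w] by (simp add: signed_perms_iff)
      ultimately have "rank i = rank j" using rank_less ij 4 by (auto dest: inj_onD)
      then show ?thesis using pos_rank ij 4 by (metis lessThan_iff)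
    qed
  qed
qed

text \<open>Relabelling keeps a letter off its position, so insertion creates no further fixed
  points and \<open>F\<close> can be read off from the result.\<close>

lemma fixed_insert_fixed:
  assumes "i < n"
  shows "insert_fixed w ! i = int i + 1 \<longleftrightarrow> i \<in> F"
proof (cases "i \<in> F")
  case False
  have "w ! rank i \<noteq> int (rank i) + 1"
    using B_derangementsD(5)[OF w] rank_less assms False by blast
  then show ?thesis
    using lift_less_pos_iff[OF letter assms False, OF assms False assms False] False assms
    by (auto simp: insert_fixed_nth)
qed (use assms in \<open>simp add: insert_fixed_nth\<close>)

lemma remove_insert_fixed: "remove_fixed (insert_fixed w) = w"
proof (rule nth_equalityI)
  show "length (remove_fixed (insert_fixed w)) = length w"
    using B_derangementsD(1)[OF w] by (simp add: remove_fixed_def)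
  fix j assume "j < length (remove_fixed (insert_fixed w))"
  then have j: "j < m" by (simp add: remove_fixed_def)
  then show "remove_fixed (insert_fixed w) ! j = w ! j"
    using pos[OF j] unlift_lift[of "w ! j"] B_derangementsD[OF w]
    by (simp add: remove_fixed_def insert_fixed_nth)
qed

lemma neg_insert_fixed: "neg (insert_fixed w) = neg w"
proof -
  have "bij_betw pos {j. j < m \<and> w ! j < 0} {i. i < n \<and> insert_fixed w ! i < 0}"
  proof (rule bij_betw_byWitness[of _ rank])
    show "\<forall>j\<in>{j. j < m \<and> w ! j < 0}. rank (pos j) = j" by (simp add: pos)
    show "\<forall>i\<in>{i. i < n \<and> insert_fixed w ! i < 0}. pos (rank i) = i"
      by (auto simp: insert_fixed_nth pos_rank split: if_splits)
    show "pos ` {j. j < m \<and> w ! j < 0} \<subseteq> {i. i < n \<and> insert_fixed w ! i < 0}"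
      using lift_neg_iff[OF B_derangementsD(3,4)[OF w]] by (auto simp: insert_fixed_nth pos)
    show "rank ` {i. i < n \<and> insert_fixed w ! i < 0} \<subseteq> {j. j < m \<and> w ! j < 0}"
      using lift_neg_iff[OF letter] by (auto simp: insert_fixed_nth rank_less split: if_splits)
  qed
  from bij_betw_same_card[OF this] show ?thesis
    using B_derangementsD(1)[OF w] by (simp add: neg_def length_filter_conv_card length_insert_fixed)
qed

lemma descent_insert_fixed:
  assumes i: "0 < i" "i < n"
  shows "prec_less (insert_fixed w ! i) (insert_fixed w ! (i - 1)) \<longleftrightarrow> shuffle.shuffle_descent (excedance w) (descent_at w) F i"
proof -
  interpret shuffle "excedance w" "descent_at w" m by (rule shuffle_B_derangement[OF w])
  have i': "i - 1 < n" using i by simp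
  have fx: "insert_fixed w ! j \<noteq> int j + 1" if "j < n" "j \<notin> F" for j
    using fixed_insert_fixed that by blast
  have nz: "insert_fixed w ! j \<noteq> 0" if "j < n" for j
    using insert_fixed_signed_perms that by (auto simp: signed_perms_iff)
  have inj: "insert_fixed w ! i \<noteq> int (i - 1) + 1" if "i - 1 \<in> F"
  proof
    assume "insert_fixed w ! i = int (i - 1) + 1"
    also have "\<dots> = insert_fixed w ! (i - 1)" using that i' by (simp add: insert_fixed_nth)
    finally have "i = i - 1"
      using insert_fixed_signed_perms i i' inj_onD[of "\<lambda>i. \<bar>insert_fixed w ! i\<bar>" "{..<n}" i "i - 1"]
      by (simp add: signed_perms_iff)
    with i show False by simp
  qed
  consider "i \<in> F" "i - 1 \<in> F" | "i \<in> F" "i - 1 \<notin> F" | "i \<notin> F" "i - 1 \<in> F" | "i \<notin> F" "i - 1 \<notin> F"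
    by blast
  then show ?thesis
  proof cases
    case 1
    then have "\<not> shuffle_descent F i" unfolding shuffle_descent_def by simp
    moreover have "\<not> prec_less (insert_fixed w ! i) (insert_fixed w ! (i - 1))"
      using 1 i by (simp add: insert_fixed_nth prec_less_def)
    ultimately show ?thesis by blast
  next
    case 2
    have "prec_less (insert_fixed w ! i) (insert_fixed w ! (i - 1)) \<longleftrightarrow> int i + 1 < lift (w ! rank (i - 1))"
      using i i' 2 by (auto simp: insert_fixed_nth prec_less_def)
    \<comment> \<open>The bound moves from the position of the fixed point to the letter's own
      position. Only the value \<open>int i + 1\<close> could tell the two bounds apart, and the
      fixed point already uses it.\<close>
    also have "\<dots> \<longleftrightarrow> int (i - 1) + 1 < lift (w ! rank (i - 1))"
      using lift_neq[OF letter[OF i' 2(2)] 2(1)] i by auto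
    also have "\<dots> \<longleftrightarrow> excedance w (rank (i - 1))"
      unfolding excedance_def by (rule lift_less_pos_iff[OF letter i' 2(2), OF i' 2(2) i' 2(2)])
    finally show ?thesis unfolding shuffle_descent_def rank_def using 2 by simp
  next
    case 3
    have "prec_less (insert_fixed w ! i) (insert_fixed w ! (i - 1)) \<longleftrightarrow> insert_fixed w ! i < int (i - 1) + 1"
      using i i' 3 nz[OF i(2)] by (auto simp: insert_fixed_nth prec_less_def)
    \<comment> \<open>The same move of the bound: the separating value belongs to the fixed point at
      \<open>i - 1\<close>, which \<open>inj\<close> excludes.\<close>
    also have "\<dots> \<longleftrightarrow> insert_fixed w ! i < int i + 1"
      using inj[OF 3(2)] i by auto
    also have "\<dots> \<longleftrightarrow> w ! rank i < int (rank i) + 1"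
      using lift_less_pos_iff(1)[OF letter i(2) 3(1), OF i(2) 3(1) i(2) 3(1)] i 3 by (simp add: insert_fixed_nth)
    also have "\<dots> \<longleftrightarrow> \<not> excedance w (rank i)"
      using B_derangementsD(5)[OF w rank_less[OF i(2) 3(1)]] by (auto simp: excedance_def)
    finally show ?thesis unfolding shuffle_descent_def rank_def using 3 by simp
  next
    case 4
    have "rank i = Suc (rank (i - 1))" using rank_Suc[of "i - 1"] 4 i by simp
    then have "prec_less (insert_fixed w ! i) (insert_fixed w ! (i - 1)) \<longleftrightarrow> descent_at w (rank i)"
      using 4 i i' prec_less_lift[OF letter[OF i(2) 4(1)] letter[OF i' 4(2)]]
      by (simp add: insert_fixed_nth descent_at_def)
    then show ?thesis unfolding shuffle_descent_def rank_def using 4 by simp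
  qed
qed

lemma fmaj_insert_fixed: "fmaj (insert_fixed w) = 2 * shuffle.shuffle_maj (excedance w) (descent_at w) n F + neg w"
proof -
  interpret shuffle "excedance w" "descent_at w" m by (rule shuffle_B_derangement[OF w])
  have "maj_prec (insert_fixed w) = shuffle_maj n F"
    unfolding maj_prec_def shuffle_maj_def
  proof (rule sum.cong)
    fix i assume "i \<in> {1..<n}"
    then have "0 < i" "i < n" by auto
    from descent_insert_fixed[OF this]
    show "(if prec_less (insert_fixed w ! i) (insert_fixed w ! (i - 1)) then i else 0)
        = (if shuffle_descent F i then i else 0)" by (simp only:)
  qed (simp add: length_insert_fixed)
  then show ?thesis by (simp add: fmaj_def neg_insert_fixed)
qed

text \<open>A fixed point in the last position is the letter n, outside the range. Otherwise the
  last letter is a relabelled letter of the derangement with the same sign, and it cannot be n, as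
  that would be a new fixed point.\<close>

lemma last_insert_fixed:
  assumes "0 < n"
  shows "last (insert_fixed w) \<in> {1..int n - 1} \<longleftrightarrow> n - 1 \<notin> F \<and> 0 < last w"
proof (cases "n - 1 \<in> F")
  case True
  then show ?thesis using assms by (simp add: insert_fixed_def last_map)
next
  case False
  have n1: "n - 1 < n" using assms by simp
  have r: "m = Suc (rank (n - 1))" using rank_Suc[of "n - 1"] False assms rank_n by simp
  have "last (insert_fixed w) = insert_fixed w ! (n - 1)"
    using assms by (subst last_conv_nth) (auto simp: insert_fixed_def)
  also have "\<dots> = lift (w ! rank (n - 1))" using False n1 by (simp add: insert_fixed_nth)
  also have "w ! rank (n - 1) = last w"
    using r B_derangementsD(1)[OF w] by (subst last_conv_nth) auto
  finally have l: "last (insert_fixed w) = lift (last w)" .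
  have lw: "last w \<noteq> 0" "\<bar>last w\<bar> \<le> int m"
    using letter[OF n1 False] \<open>w ! rank (n - 1) = last w\<close> by simp_all
  have "insert_fixed w ! (n - 1) \<noteq> int n"
    using fixed_insert_fixed[OF n1] False assms by simp
  then have "lift (last w) \<noteq> int n"
    using l \<open>last (insert_fixed w) = insert_fixed w ! (n - 1)\<close> by simp
  then show ?thesis using lift_range[OF lw] lift_neg_iff[OF lw] lw False unfolding l by auto
qed

end

text \<open>Here \<open>F\<close> is the set of all fixed points of \<open>w\<close>, so the
  remaining letters use exactly the remaining absolute values and the relabelling can be undone
  without leaving a fixed point.\<close>

lemma remove_fixed:
  assumes "w \<in> signed_perms n" and F_eq: "F = {i. i < n \<and> w ! i = int i + 1}"
  shows "remove_fixed w \<in> B_derangements m" "insert_fixed (remove_fixed w) = w"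
proof -
  have w: "length w = n" "inj_on (\<lambda>i. \<bar>w ! i\<bar>) {..<n}" "\<And>i. i < n \<Longrightarrow> \<bar>w ! i\<bar> \<in> {1..int n}"
    using assms(1) by (auto simp: signed_perms_iff)
  \<comment> \<open>A letter with absolute value f + 1 for some f in \<open>F\<close> would repeat
    the absolute value of the fixed point at f.\<close>
  have nF: "nat \<bar>w ! i\<bar> - 1 \<notin> F" if "i < n" "i \<notin> F" for i
  proof
    assume f: "nat \<bar>w ! i\<bar> - 1 \<in> F"
    define f where "f = nat \<bar>w ! i\<bar> - 1"
    have "w ! f = int f + 1" "f < n" using f F_eq by (auto simp: f_def)
    moreover have "\<bar>w ! i\<bar> = int f + 1" using w(3)[OF that(1)] by (auto simp: f_def)
    ultimately have "f = i"
      using inj_onD[OF w(2), of f i] that(1) by simp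
    with f that show False by (simp add: f_def)
  qed
  have L: "lift (unlift (w ! i)) = w ! i" "unlift (w ! i) \<noteq> 0" "\<bar>unlift (w ! i)\<bar> \<le> int m"
    if "i < n" "i \<notin> F" for i
  proof -
    have "w ! i \<noteq> 0" "\<bar>w ! i\<bar> \<le> int n" using w(3)[OF that(1)] by auto
    from lift_unlift[OF this nF[OF that]]
    show "lift (unlift (w ! i)) = w ! i" "unlift (w ! i) \<noteq> 0" "\<bar>unlift (w ! i)\<bar> \<le> int m" .
  qed
  have nth: "remove_fixed w ! j = unlift (w ! pos j)" if "j < m" for j
    using that by (simp add: remove_fixed_def)
  show "remove_fixed w \<in> B_derangements m"
    unfolding B_derangements_def signed_perms_iff mem_Collect_eq
  proof (intro conjI allI impI)
    show "length (remove_fixed w) = m" by (simp add: remove_fixed_def)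
    show "\<bar>remove_fixed w ! j\<bar> \<in> {1..int m}" if "j < m" for j
      using L[OF pos(1,2)[OF that]] by (simp add: nth that)
    show "remove_fixed w ! j \<noteq> int (j + 1)" if "j < m" for j
    proof
      assume "remove_fixed w ! j = int (j + 1)"
      then have "lift (unlift (w ! pos j)) = int (pos j) + 1"
        using that by (simp add: nth lift_def nat_add_distrib)
      then show False using L(1)[OF pos(1,2)[OF that]] pos(1,2)[OF that] F_eq by simp
    qed
    show "inj_on (\<lambda>j. \<bar>remove_fixed w ! j\<bar>) {..<m}"
    proof (rule inj_onI)
      fix j k assume jk: "j \<in> {..<m}" "k \<in> {..<m}" and "\<bar>remove_fixed w ! j\<bar> = \<bar>remove_fixed w ! k\<bar>"
      then have "\<bar>unlift (w ! pos j)\<bar> = \<bar>unlift (w ! pos k)\<bar>" by (simp add: nth)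
      then have "\<bar>lift (unlift (w ! pos j))\<bar> = \<bar>lift (unlift (w ! pos k))\<bar>"
        by (auto simp: lift_def abs_mult abs_sgn_eq)
      then have "\<bar>w ! pos j\<bar> = \<bar>w ! pos k\<bar>" using L(1) pos jk by simp
      then have "pos j = pos k" using inj_onD[OF w(2), of "pos j" "pos k"] pos(1) jk by simp
      then show "j = k" using pos(3) jk by (metis lessThan_iff)
    qed
  qed
  show "insert_fixed (remove_fixed w) = w"
  proof (rule nth_equalityI)
    show "length (insert_fixed (remove_fixed w)) = length w" using w by (simp add: insert_fixed_def)
    fix i assume "i < length (insert_fixed (remove_fixed w))"
    then have i: "i < n" by (simp add: insert_fixed_def)
    show "insert_fixed (remove_fixed w) ! i = w ! i"
    proof (cases "i \<in> F")
      case True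
      then have "insert_fixed (remove_fixed w) ! i = int i + 1" using i by (simp add: insert_fixed_def)
      with True F_eq show ?thesis by simp
    next
      case False
      then show ?thesis using i L(1)[OF i False] nth[OF rank_less[OF i False]] pos_rank[OF i False]
        by (simp add: insert_fixed_def)
    qed
  qed
qed

end

section \<open>Derangement polynomials\<close>

lemma finite_signed_perms: "finite (signed_perms n)"
  by (simp add: signed_perms_eq finite_signed_words)

lemma finite_B_derangements: "finite (B_derangements n)"
  by (rule finite_subset[OF _ finite_signed_perms]) (auto simp: B_derangements_def)

lemma bij_betw_insert_fixed:
  "bij_betw (\<lambda>(F, w). fixed_positions.insert_fixed n F w)
     (SIGMA F:Pow {..<n}. B_derangements (n - card F)) (signed_perms n)"
proof (rule bij_betw_byWitness[of _ "\<lambda>w. let F = {i. i < n \<and> w ! i = int i + 1} in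
      (F, fixed_positions.remove_fixed n F w)"])
  show "\<forall>a\<in>SIGMA F:Pow {..<n}. B_derangements (n - card F).
      (let F = {i. i < n \<and> (case a of (F, w) \<Rightarrow> fixed_positions.insert_fixed n F w) ! i = int i + 1} in
      (F, fixed_positions.remove_fixed n F (case a of (F, w) \<Rightarrow> fixed_positions.insert_fixed n F w))) = a"
  proof (clarify)
    fix F w assume F: "F \<subseteq> {..<n}" and w: "w \<in> B_derangements (n - card F)"
    interpret fixed_positions n F by standard (rule F)
    have "{i. i < n \<and> insert_fixed w ! i = int i + 1} = F"
      using fixed_insert_fixed w F by (auto simp: m_def)
    then show "(let F = {i. i < n \<and> insert_fixed w ! i = int i + 1} in
      (F, fixed_positions.remove_fixed n F (insert_fixed w))) = (F, w)"
      using remove_insert_fixed w by (simp add: m_def)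
  qed
  have *: "fixed_positions.insert_fixed n F (fixed_positions.remove_fixed n F w) = w
      \<and> fixed_positions.remove_fixed n F w \<in> B_derangements (n - card F)"
    if "w \<in> signed_perms n" "F = {i. i < n \<and> w ! i = int i + 1}" for w F
  proof -
    interpret fixed_positions n F by standard (use that in auto)
    show ?thesis using remove_fixed[OF that] by (simp add: m_def)
  qed
  then show "\<forall>w\<in>signed_perms n. (case (let F = {i. i < n \<and> w ! i = int i + 1} in
      (F, fixed_positions.remove_fixed n F w)) of (F, w) \<Rightarrow> fixed_positions.insert_fixed n F w) = w"
    by (auto simp: Let_def)
  show "(\<lambda>(F, w). fixed_positions.insert_fixed n F w) `
      (SIGMA F:Pow {..<n}. B_derangements (n - card F)) \<subseteq> signed_perms n"
  proof clarify
    fix F w assume F: "F \<subseteq> {..<n}" and w: "w \<in> B_derangements (n - card F)"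
    interpret fixed_positions n F by standard (rule F)
    show "insert_fixed w \<in> signed_perms n" using insert_fixed_signed_perms w by (simp add: m_def)
  qed
  show "(\<lambda>w. let F = {i. i < n \<and> w ! i = int i + 1} in (F, fixed_positions.remove_fixed n F w)) ` signed_perms n
      \<subseteq> (SIGMA F:Pow {..<n}. B_derangements (n - card F))"
    using * by (auto simp: Let_def)
qed

text \<open>The summand \<open>g\<close> is arbitrary so that it can also encode a condition on the
  last letter.\<close>

lemma sum_signed_perms_decompose:
  "(\<Sum>w\<in>signed_perms n. g w)
    = (\<Sum>k\<le>n. \<Sum>w\<in>B_derangements (n - k). \<Sum>F\<in>ksubsets n k. g (fixed_positions.insert_fixed n F w))"
proof -
  have "(\<Sum>w\<in>signed_perms n. g w)
      = (\<Sum>F\<in>Pow {..<n}. \<Sum>w\<in>B_derangements (n - card F). g (fixed_positions.insert_fixed n F w))"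
    unfolding sum.reindex_bij_betw[OF bij_betw_insert_fixed, symmetric]
    by (subst sum.Sigma) (auto simp: finite_B_derangements case_prod_unfold)
  also have "\<dots> = (\<Sum>k\<le>n. \<Sum>F | F \<in> Pow {..<n} \<and> card F = k.
      \<Sum>w\<in>B_derangements (n - card F). g (fixed_positions.insert_fixed n F w))"
    by (rule sum.group[symmetric]) (auto intro: card_mono[of "{..<n}", simplified])
  also have "\<dots> = (\<Sum>k\<le>n. \<Sum>F\<in>ksubsets n k. \<Sum>w\<in>B_derangements (n - k). g (fixed_positions.insert_fixed n F w))"
    by (intro sum.cong) (auto simp: ksubsets_def)
  also have "\<dots> = (\<Sum>k\<le>n. \<Sum>w\<in>B_derangements (n - k). \<Sum>F\<in>ksubsets n k. g (fixed_positions.insert_fixed n F w))"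
    by (intro sum.cong refl sum.swap)
  finally show ?thesis .
qed

lemma last_not_high:
  assumes "w \<in> B_derangements m" "0 < m"
  shows "\<not> excedance w (m - 1)"
  using B_derangementsD(4)[OF assms(1), of "m - 1"] assms(2) by (auto simp: excedance_def)

text \<open>Insertion keeps \<open>neg\<close>, and \<open>fmaj\<close> counts
  \<open>maj_prec\<close> twice, so the shuffle sum is taken at \<open>q\<^sup>2\<close>.\<close>

lemma sum_insert_fixed:
  fixes q :: "'a::comm_ring_1"
  assumes w: "w \<in> B_derangements (n - k)" and k: "k \<le> n"
  shows "(\<Sum>F\<in>ksubsets n k. q ^ fmaj (fixed_positions.insert_fixed n F w)) = q ^ fmaj w * qbinom (q\<^sup>2) n k"
proof -
  interpret shuffle "excedance w" "descent_at w" "n - k" by (rule shuffle_B_derangement[OF w])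
  have fm: "fmaj (fixed_positions.insert_fixed n F w) = 2 * shuffle_maj n F + neg w" if "F \<in> ksubsets n k" for F
  proof -
    interpret fixed_positions n F by standard (use that in \<open>simp add: ksubsets_def\<close>)
    show ?thesis using fmaj_insert_fixed[of w] w that by (simp add: m_def ksubsets_def)
  qed
  have "(\<Sum>F\<in>ksubsets n k. q ^ fmaj (fixed_positions.insert_fixed n F w)) = q ^ neg w * (\<Sum>F\<in>ksubsets n k. (q\<^sup>2) ^ shuffle_maj n F)"
    unfolding sum_distrib_left
    by (intro sum.cong refl) (simp add: fm power_add power_mult mult.commute)
  also have "(\<Sum>F\<in>ksubsets n k. (q\<^sup>2) ^ shuffle_maj n F) = (q\<^sup>2) ^ maj_prec w * qbinom (q\<^sup>2) n k"
  proof -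
    have "n = k \<or> \<not> excedance w (n - k - 1)" using last_not_high[OF w] k by auto
    from sum_shuffle_maj[OF k order.refl this] show ?thesis by (simp only: base_maj_eq_maj_prec[OF w])
  qed
  finally show ?thesis by (simp only: fmaj_def power_add power_mult) (simp only: mult_ac)
qed

text \<open>The factor \<open>(q\<^sup>2) ^ k\<close> is the price in \<open>end_out\<close> of a
  low last base letter, which \<open>last_not_high\<close> guarantees.\<close>

lemma sum_insert_fixed_last:
  fixes q :: "'a::comm_ring_1"
  assumes w: "w \<in> B_derangements (n - k)" and k: "k < n"
  shows "(\<Sum>F | F \<in> ksubsets n k \<and> n - 1 \<notin> F. q ^ fmaj (fixed_positions.insert_fixed n F w))
    = (q\<^sup>2) ^ k * q ^ fmaj w * qbinom (q\<^sup>2) (n - 1) k"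
proof -
  interpret shuffle "excedance w" "descent_at w" "n - k" by (rule shuffle_B_derangement[OF w])
  have fm: "fmaj (fixed_positions.insert_fixed n F w) = 2 * shuffle_maj n F + neg w" if "F \<in> ksubsets n k" for F
  proof -
    interpret fixed_positions n F by standard (use that in \<open>simp add: ksubsets_def\<close>)
    show ?thesis using fmaj_insert_fixed[of w] w that by (simp add: m_def ksubsets_def)
  qed
  have "(\<Sum>F | F \<in> ksubsets n k \<and> n - 1 \<notin> F. q ^ fmaj (fixed_positions.insert_fixed n F w)) = q ^ neg w * end_out (q\<^sup>2) n k"
    unfolding sum_distrib_left end_out_def
    by (intro sum.cong refl) (simp add: fm power_add power_mult mult.commute)
  also have "end_out (q\<^sup>2) n k = (q\<^sup>2) ^ (maj_prec w + k) * qbinom (q\<^sup>2) (n - 1) k"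
    using end_out_end_in_eq[of "n - k" "q\<^sup>2" k] last_not_high[OF w] k by (simp add: base_maj_eq_maj_prec[OF w])
  finally show ?thesis by (simp only: fmaj_def power_add power_mult) (simp only: mult_ac)
qed

definition der_poly :: "'a::comm_ring_1 \<Rightarrow> nat \<Rightarrow> 'a" where
  "der_poly q n = (\<Sum>w\<in>B_derangements n. q ^ fmaj w)"

definition der_poly_last_pos :: "'a::comm_ring_1 \<Rightarrow> nat \<Rightarrow> 'a" where
  "der_poly_last_pos q n = (\<Sum>w | w \<in> B_derangements n \<and> 0 < last w. q ^ fmaj w)"

lemma der_poly_convolution: "dbl_qfact q n = (\<Sum>k\<le>n. qbinom (q\<^sup>2) n k * der_poly q (n - k))"
proof -
  have "dbl_qfact q n = (\<Sum>k\<le>n. \<Sum>w\<in>B_derangements (n - k).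
      \<Sum>F\<in>ksubsets n k. q ^ fmaj (fixed_positions.insert_fixed n F w))"
    unfolding sum_signed_perms[symmetric] by (rule sum_signed_perms_decompose)
  also have "\<dots> = (\<Sum>k\<le>n. \<Sum>w\<in>B_derangements (n - k). q ^ fmaj w * qbinom (q\<^sup>2) n k)"
    by (intro sum.cong refl) (simp add: sum_insert_fixed)
  finally show ?thesis by (simp add: der_poly_def sum_distrib_left mult.commute)
qed

lemma der_poly_last_pos_convolution:
  "q * qint N q * dbl_qfact q N = (\<Sum>k\<le>N. (q\<^sup>2) ^ k * qbinom (q\<^sup>2) N k * der_poly_last_pos q (Suc N - k))"
proof -
  define n where "n = Suc N"
  \<comment> \<open>The condition \<open>k < n\<close> has to be stated: for \<open>k = n\<close>
    the word \<open>w\<close> is empty, so \<open>last w\<close> is unspecified, and the only choice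
    of \<open>F\<close> occupies the last position.\<close>
  have term_eq: "(\<Sum>F\<in>ksubsets n k. if last (fixed_positions.insert_fixed n F w) \<in> {1..int N}
        then q ^ fmaj (fixed_positions.insert_fixed n F w) else 0)
      = (if k < n \<and> 0 < last w then (q\<^sup>2) ^ k * q ^ fmaj w * qbinom (q\<^sup>2) N k else 0)"
    if k: "k \<le> n" and w: "w \<in> B_derangements (n - k)" for k w
  proof -
    have "(\<Sum>F\<in>ksubsets n k. if last (fixed_positions.insert_fixed n F w) \<in> {1..int N}
        then q ^ fmaj (fixed_positions.insert_fixed n F w) else 0)
      = (\<Sum>F\<in>ksubsets n k. if n - 1 \<notin> F then if 0 < last w then q ^ fmaj (fixed_positions.insert_fixed n F w) else 0 else 0)"
    proof (intro sum.cong refl)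
      fix F assume Fk: "F \<in> ksubsets n k"
      interpret fixed_positions n F by standard (use Fk in \<open>simp add: ksubsets_def\<close>)
      have "last (insert_fixed w) \<in> {1..int N} \<longleftrightarrow> n - 1 \<notin> F \<and> 0 < last w"
      proof -
        have "w \<in> B_derangements m" using w ksubsetsD[OF Fk] by (simp add: m_def)
        from last_insert_fixed[OF this] show ?thesis by (simp add: n_def)
      qed
      then show "(if last (insert_fixed w) \<in> {1..int N} then q ^ fmaj (insert_fixed w) else 0)
          = (if n - 1 \<notin> F then if 0 < last w then q ^ fmaj (insert_fixed w) else 0 else 0)"
        by simp
    qed
    also have "\<dots> = (\<Sum>F | F \<in> ksubsets n k \<and> n - 1 \<notin> F. if 0 < last w then q ^ fmaj (fixed_positions.insert_fixed n F w) else 0)"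
      by (simp only: sum.inter_filter[OF finite_ksubsets])
    also have "\<dots> = (if k < n \<and> 0 < last w then (q\<^sup>2) ^ k * q ^ fmaj w * qbinom (q\<^sup>2) N k else 0)"
    proof (cases "k < n")
      case True
      then show ?thesis using sum_insert_fixed_last[OF w True, of q] by (simp add: n_def)
    next
      case False
      then have E: "{F. F \<in> ksubsets n k \<and> n - 1 \<notin> F} = {}" using k by (auto simp: ksubsets_full n_def)
      show ?thesis unfolding E using False by simp
    qed
    finally show ?thesis .
  qed
  have "q * qint N q * dbl_qfact q N
      = (\<Sum>w\<in>signed_perms n. if last w \<in> {1..int N} then q ^ fmaj w else 0)"
    unfolding sum_signed_perms_last_pos[symmetric] n_def by (rule sum.inter_filter[OF finite_signed_perms])
  also have "\<dots> = (\<Sum>k\<le>n. \<Sum>w\<in>B_derangements (n - k).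
      if k < n \<and> 0 < last w then (q\<^sup>2) ^ k * q ^ fmaj w * qbinom (q\<^sup>2) N k else 0)"
    unfolding sum_signed_perms_decompose by (intro sum.cong refl term_eq) auto
  also have "\<dots> = (\<Sum>k\<le>N. \<Sum>w\<in>B_derangements (n - k).
      if 0 < last w then (q\<^sup>2) ^ k * q ^ fmaj w * qbinom (q\<^sup>2) N k else 0)"
    by (simp add: n_def)
  also have "\<dots> = (\<Sum>k\<le>N. (q\<^sup>2) ^ k * qbinom (q\<^sup>2) N k * der_poly_last_pos q (n - k))"
    unfolding der_poly_last_pos_def sum.inter_filter[OF finite_B_derangements] sum_distrib_left
    by (intro sum.cong refl) (simp add: mult_ac)
  finally show ?thesis by (simp add: n_def)
qed


section \<open>Closed forms at q and -q by inversion\<close>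

lemma qint_double: "qint (2 * j) q = (1 + q) * qint j (q\<^sup>2)"
  by (induction j) (simp_all add: qint_def power_mult power_add algebra_simps power2_eq_square)

lemma qint_minus: "(1 + q) * qint (2 * j) (- q) = (1 - q) * qint (2 * j) q"
  by (simp add: qint_double)

text \<open>Origin of the ratio in the final formula: in \<open>qint (2 * j) q\<close> only the
  factor 1 + q changes when q is replaced by -q, and each of the n factors contributes one
  quotient.\<close>

lemma dbl_qfact_minus:
  fixes q :: "'a::field"
  assumes "1 + q \<noteq> 0"
  shows "dbl_qfact (- q) n = ((1 - q) / (1 + q)) ^ n * dbl_qfact q n"
proof -
  have "qint (2 * j) (- q) = (1 - q) / (1 + q) * qint (2 * j) q" for j
    using qint_minus[of q j] assms by (simp add: field_simps)
  then show ?thesis by (simp only: dbl_qfact_def prod.distrib) simp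
qed

lemma dbl_qfact_eq: "dbl_qfact q n = (1 + q) ^ n * qfact (q\<^sup>2) n"
  by (simp add: dbl_qfact_def qfact_def qint_double prod.distrib)

text \<open>The powers of 1 + q that separate \<open>dbl_qfact\<close> from \<open>qfact\<close>
  balance, because k + (N - k) = N.\<close>

lemma qbinom_dbl_qfact:
  fixes q :: "'a::field"
  assumes "\<And>j. j \<in> {1..N} \<Longrightarrow> qint (2 * j) q \<noteq> 0" "k \<le> N"
  shows "qbinom (q\<^sup>2) N k * dbl_qfact q (N - k) = dbl_qfact q N / dbl_qfact q k"
proof -
  have "dbl_qfact q k \<noteq> 0" unfolding dbl_qfact_def by (subst prod_zero_iff) (use assms in auto)
  moreover have "qbinom (q\<^sup>2) N k * dbl_qfact q (N - k) * dbl_qfact q k = dbl_qfact q N"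
    using qbinom_qfact[OF assms(2), of "q\<^sup>2"] assms(2)
    by (simp add: dbl_qfact_eq power_add[symmetric] mult_ac flip: power_add) 
  ultimately show ?thesis by (simp add: field_simps)
qed

context
  fixes q :: "'a::field" and N :: nat
  assumes q: "1 + q \<noteq> 0" and nz: "\<And>j. j \<in> {1..N} \<Longrightarrow> qint (2 * j) q \<noteq> 0"
begin

lemma qint_square_nonzero: "j \<in> {1..N} \<Longrightarrow> qint j (q\<^sup>2) \<noteq> 0"
  using nz[of j] by (simp add: qint_double)

lemma der_poly_formula:
  "der_poly q N = (\<Sum>k\<le>N. (-1) ^ k * q ^ (2 * (k choose 2)) * (dbl_qfact q N / dbl_qfact q k))"
proof -
  have "der_poly q N = (\<Sum>k\<le>N. (-1) ^ k * (q\<^sup>2) ^ (k choose 2) * qbinom (q\<^sup>2) N k * dbl_qfact q (N - k))"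
    by (rule qbinom_inversion[of N "q\<^sup>2" _ 1]) (use qint_square_nonzero in \<open>simp_all add: der_poly_convolution\<close>)
  also have "\<dots> = (\<Sum>k\<le>N. (-1) ^ k * q ^ (2 * (k choose 2)) * (dbl_qfact q N / dbl_qfact q k))"
  proof (intro sum.cong refl)
    fix k assume "k \<in> {..N}"
    then have "k \<le> N" by simp
    show "(-1) ^ k * (q\<^sup>2) ^ (k choose 2) * qbinom (q\<^sup>2) N k * dbl_qfact q (N - k)
      = (-1) ^ k * q ^ (2 * (k choose 2)) * (dbl_qfact q N / dbl_qfact q k)"
      by (simp only: qbinom_dbl_qfact[OF nz \<open>k \<le> N\<close>, symmetric] power_mult mult.assoc)
  qed
  finally show ?thesis .
qed

lemma der_poly_minus_formula:
  "der_poly (- q) N = (\<Sum>k\<le>N. (-1) ^ k * q ^ (2 * (k choose 2)) * (dbl_qfact q N / dbl_qfact q k)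
     * ((1 - q) / (1 + q)) ^ (N - k))"
proof -
  have "der_poly (- q) N = (\<Sum>k\<le>N. (-1) ^ k * (q\<^sup>2) ^ (k choose 2) * qbinom (q\<^sup>2) N k * dbl_qfact (- q) (N - k))"
    \<comment> \<open>The q-binomials have base \<open>q\<^sup>2\<close>, which is the same for q
      and -q, so only the double factorial changes.\<close>
    by (rule qbinom_inversion[of N "q\<^sup>2" _ 1]) (use qint_square_nonzero der_poly_convolution[of "- q"] in \<open>simp_all\<close>)
  also have "\<dots> = (\<Sum>k\<le>N. (-1) ^ k * q ^ (2 * (k choose 2)) * (dbl_qfact q N / dbl_qfact q k)
     * ((1 - q) / (1 + q)) ^ (N - k))"
  proof (intro sum.cong refl)
    fix k assume "k \<in> {..N}"
    then have "k \<le> N" by simp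
    show "(-1) ^ k * (q\<^sup>2) ^ (k choose 2) * qbinom (q\<^sup>2) N k * dbl_qfact (- q) (N - k)
      = (-1) ^ k * q ^ (2 * (k choose 2)) * (dbl_qfact q N / dbl_qfact q k) * ((1 - q) / (1 + q)) ^ (N - k)"
      by (simp only: qbinom_dbl_qfact[OF nz \<open>k \<le> N\<close>, symmetric] dbl_qfact_minus[OF q] power_mult)
         (simp only: mult_ac)
  qed
  finally show ?thesis .
qed

lemma der_poly_last_pos_formula:
  "der_poly_last_pos q (Suc N) = (\<Sum>k\<le>N. (-1) ^ k * q ^ (2 * (k choose 2)) * (dbl_qfact q N / dbl_qfact q k)
     * (q ^ (2 * k + 1) * qint (N - k) q))"
proof -
  have "der_poly_last_pos q (Suc N) = (\<Sum>k\<le>N. (- (q\<^sup>2)) ^ k * (q\<^sup>2) ^ (k choose 2) * qbinom (q\<^sup>2) N k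
      * (q * qint (N - k) q * dbl_qfact q (N - k)))"
    \<comment> \<open>The index of the unknown sequence is shifted by one, since the convolution has
      no term for the empty derangement. The weight \<open>q\<^sup>2\<close> and the leading q
      combine to \<open>q ^ (2 * k + 1)\<close>.\<close>
    by (rule qbinom_inversion[of N "q\<^sup>2" "\<lambda>M. q * qint M q * dbl_qfact q M" "q\<^sup>2" "\<lambda>n. der_poly_last_pos q (Suc n)"])
       (use qint_square_nonzero in \<open>simp_all add: der_poly_last_pos_convolution Suc_diff_le\<close>)
  also have "\<dots> = (\<Sum>k\<le>N. (-1) ^ k * q ^ (2 * (k choose 2)) * (dbl_qfact q N / dbl_qfact q k)
     * (q ^ (2 * k + 1) * qint (N - k) q))"
  proof (intro sum.cong refl)
    fix k assume "k \<in> {..N}"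
    then have "k \<le> N" by simp
    show "(- (q\<^sup>2)) ^ k * (q\<^sup>2) ^ (k choose 2) * qbinom (q\<^sup>2) N k * (q * qint (N - k) q * dbl_qfact q (N - k))
      = (-1) ^ k * q ^ (2 * (k choose 2)) * (dbl_qfact q N / dbl_qfact q k) * (q ^ (2 * k + 1) * qint (N - k) q)"
      by (simp only: qbinom_dbl_qfact[OF nz \<open>k \<le> N\<close>, symmetric] power_mult power_add power_one_right
            power_minus[of "q\<^sup>2"]) (simp only: mult_ac)
  qed
  finally show ?thesis .
qed

end

section \<open>From even derangements to type B derangements\<close>

lemma fmaj_parity: "(- q) ^ fmaj w = (-1) ^ neg w * q ^ fmaj w" for q :: "'a::comm_ring_1"
  by (subst power_minus) (simp add: fmaj_def power_add power_mult)

lemma der_poly_minus: "der_poly q n - der_poly (- q) n = 2 * (\<Sum>w | w \<in> B_derangements n \<and> odd (neg w). q ^ fmaj w)"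
  unfolding der_poly_def sum_subtractf[symmetric] sum_distrib_left sum.inter_filter[OF finite_B_derangements]
  by (rule sum.cong) (auto simp: fmaj_parity minus_one_power_iff)

lemma snoc_signed_perms_iff:
  "w @ [x] \<in> signed_perms n \<longleftrightarrow> w @ [\<bar>x\<bar>] \<in> signed_perms n"
  by (simp add: signed_perms_eq snoc_in_signed_words)

lemma snoc_Suc_signed_perms: "w @ [int (Suc N)] \<in> signed_perms (Suc N) \<longleftrightarrow> w \<in> signed_perms N"
proof -
  have "{1..int (Suc N)} - {int (Suc N)} = {1..int N}" by auto
  then show ?thesis by (simp add: signed_perms_eq snoc_in_signed_words del: of_nat_Suc)
qed

text \<open>The last letter -n is treated apart because its absolute value is a fixed point. Any
  other last letter x has an absolute value different from n, so the changed word is still a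
  derangement.\<close>

lemma sum_Dmaj_eq:
  fixes q :: "'a::comm_ring_1"
  shows "(\<Sum>w\<in>D_derangements (Suc N). q ^ Dmaj w)
    = der_poly_last_pos q (Suc N) + (\<Sum>w | w \<in> B_derangements N \<and> odd (neg w). q ^ fmaj w)"
proof -
  define n where "n = Suc N"
  define D where "D = D_derangements n"
  have fin: "finite D"
    unfolding D_def
    by (rule finite_subset[OF _ finite_signed_perms[of n]]) (auto simp: D_derangements_def even_signed_perms_def)
  have mem: "u @ [x] \<in> D \<longleftrightarrow> u @ [x] \<in> signed_perms n \<and> even (neg (u @ [x]))
      \<and> (\<forall>i<N. u ! i \<noteq> int (i + 1)) \<and> x \<noteq> int n" if "length u = N" for u x
    unfolding D_def D_derangements_def even_signed_perms_def
    using that by (auto simp: n_def nth_append less_Suc_eq)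
  have memB: "u @ [x] \<in> B_derangements n \<longleftrightarrow> u @ [x] \<in> signed_perms n
      \<and> (\<forall>i<N. u ! i \<noteq> int (i + 1)) \<and> x \<noteq> int n" if "length u = N" for u x
    unfolding B_derangements_def using that by (auto simp: n_def nth_append less_Suc_eq)
  have snoc: "\<exists>u x. w = u @ [x] \<and> length u = N" if "w \<in> signed_perms n" for w
    using that by (auto simp: signed_perms_def n_def length_Suc_conv_rev)
  have lenN: "length u = N" if "u @ [x] \<in> signed_perms n" for u x
    using that by (simp add: signed_perms_def n_def)
  have DS: "D \<subseteq> signed_perms n" by (auto simp: D_def D_derangements_def even_signed_perms_def)
  have BS: "B_derangements n \<subseteq> signed_perms n" by (auto simp: B_derangements_def)
  have 1: "(\<Sum>w | w \<in> D \<and> last w \<noteq> - int n. q ^ Dmaj w)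
      = (\<Sum>w | w \<in> B_derangements n \<and> 0 < last w. q ^ fmaj w)"
  \<comment> \<open>The lost sign can be restored: the number of negative letters of the whole word
    is even, so the parity of the other letters decides the sign of the last one.\<close>
  proof (rule sum.reindex_bij_witness[of _
        "\<lambda>w. butlast w @ [if even (neg (butlast w)) then last w else - last w]"
        "\<lambda>w. butlast w @ [\<bar>last w\<bar>]"])
    fix w assume "w \<in> {w \<in> D. last w \<noteq> - int n}"
    then obtain u x where w: "w = u @ [x]" "length u = N" "u @ [x] \<in> D" "x \<noteq> - int n"
      using snoc DS by fastforce
    have x: "x \<noteq> 0"
      using w(3) DS snoc_in_signed_words[of u x "{1..int n}"] by (auto simp: signed_perms_eq)
    have e: "even (neg u) \<longleftrightarrow> 0 < x" using w(3) mem[OF w(2)] x by (auto simp: neg_snoc split: if_splits)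
    show "butlast (butlast w @ [\<bar>last w\<bar>]) @
        [if even (neg (butlast (butlast w @ [\<bar>last w\<bar>]))) then last (butlast w @ [\<bar>last w\<bar>])
         else - last (butlast w @ [\<bar>last w\<bar>])] = w"
      using e w(1) by auto
    show "butlast w @ [\<bar>last w\<bar>] \<in> {w \<in> B_derangements n. 0 < last w}"
      using w mem[OF w(2)] memB[OF w(2)] snoc_signed_perms_iff x by (auto simp: abs_if)
    show "q ^ fmaj (butlast w @ [\<bar>last w\<bar>]) = q ^ Dmaj w" by (simp add: Dmaj_def)
  next
    fix w assume "w \<in> {w \<in> B_derangements n. 0 < last w}"
    then obtain u x where w: "w = u @ [x]" "length u = N" "u @ [x] \<in> B_derangements n" "0 < x"
      using snoc BS by fastforce
    define y where "y = (if even (neg u) then x else - x)"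
    have y: "butlast w @ [if even (neg (butlast w)) then last w else - last w] = u @ [y]" "\<bar>y\<bar> = x"
      using w by (auto simp: y_def)
    show "butlast (butlast w @ [if even (neg (butlast w)) then last w else - last w]) @
        [\<bar>last (butlast w @ [if even (neg (butlast w)) then last w else - last w])\<bar>] = w"
      using w(1) y by simp
    have "u @ [y] \<in> D"
      using w memB[OF w(2)] mem[OF w(2)] snoc_signed_perms_iff[of u y n] y(2)
      by (auto simp: neg_snoc y_def)
    then show "butlast w @ [if even (neg (butlast w)) then last w else - last w] \<in> {w \<in> D. last w \<noteq> - int n}"
      using w memB[OF w(2)] unfolding y(1) by (auto simp: y_def)
  qed
  have 2: "(\<Sum>w | w \<in> D \<and> last w = - int n. q ^ Dmaj w)
      = (\<Sum>w | w \<in> B_derangements N \<and> odd (neg w). q ^ fmaj w)"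
  proof (rule sum.reindex_bij_witness[of _ "\<lambda>u. u @ [- int n]" butlast])
    fix w assume "w \<in> {w \<in> D. last w = - int n}"
    then obtain u where w: "w = u @ [- int n]" "length u = N" "u @ [- int n] \<in> D"
      using snoc DS by fastforce
    have "u @ [int n] \<in> signed_perms n"
      using w(3) DS snoc_signed_perms_iff[of u "- int n" n] by auto
    then have u: "u \<in> signed_perms N" unfolding n_def by (simp only: snoc_Suc_signed_perms)
    show "butlast w @ [- int n] = w" by (simp add: w)
    show "butlast w \<in> {w \<in> B_derangements N. odd (neg w)}"
      using u w mem[OF w(2)] by (simp add: B_derangements_def neg_snoc n_def)
    \<comment> \<open>The new last letter n is the largest one, hence creates no descent, and it is
      positive; dropping it leaves \<open>fmaj\<close> unchanged.\<close>
    have "\<not> prec_less (int n) (last u)" if "u \<noteq> []"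
    proof -
      have "\<bar>last u\<bar> \<in> set (map abs u)" using that by simp
      then have "\<bar>last u\<bar> \<le> int N" using u by (simp add: signed_perms_def)
      then show ?thesis by (auto simp: prec_less_def n_def)
    qed
    then show "q ^ fmaj (butlast w) = q ^ Dmaj w"
      by (auto simp: w Dmaj_def fmaj_snoc n_def add.commute)
  next
    fix u assume u: "u \<in> {w \<in> B_derangements N. odd (neg w)}"
    then have "length u = N" "u \<in> signed_perms N" using B_derangementsD by auto
    then show "u @ [- int n] \<in> {w \<in> D. last w = - int n}"
      using u mem[of u "- int n"] snoc_signed_perms_iff[of u "- int n" n] snoc_Suc_signed_perms[of u N]
      by (simp add: n_def neg_snoc B_derangements_def add.commute)
  qed simp
  have "(\<Sum>w\<in>D. q ^ Dmaj w) = (\<Sum>w | w \<in> D \<and> last w \<noteq> - int n. q ^ Dmaj w)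
      + (\<Sum>w | w \<in> D \<and> last w = - int n. q ^ Dmaj w)"
    by (subst sum.union_disjoint[symmetric]) (use fin in \<open>auto intro: sum.cong\<close>)
  from this[unfolded 1 2] show ?thesis by (simp only: der_poly_last_pos_def D_def n_def)
qed

theorem theorem4p4:
  fixes q :: "'a::field_char_0" and n :: nat
  assumes "n \<ge> 2"
    and "1 + q \<noteq> 0"
    and "\<forall>j\<in>{1..n-1}. qint (2 * j) q \<noteq> 0"
  shows "(\<Sum>w\<in>D_derangements n. q ^ Dmaj w) =
    (\<Prod>j=1..n-1. qint (2 * j) q) *
    (\<Sum>k=0..n-2. ((-1) ^ k * q ^ (2 * (k choose 2)) / (\<Prod>j=1..k. qint (2 * j) q)) *
       (q ^ (2 * k + 1) * qint (n - 1 - k) q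
        + (1 / 2) * (1 - ((1 - q) / (1 + q)) ^ (n - k - 1))))"
proof -
  obtain N where n: "n = Suc N" "0 < N" using assms(1) by (cases n) auto
  have nz: "\<And>j. j \<in> {1..N} \<Longrightarrow> qint (2 * j) q \<noteq> 0" using assms(3) n by simp
  define c where "c k = (-1) ^ k * q ^ (2 * (k choose 2)) * (dbl_qfact q N / dbl_qfact q k)" for k
  define r where "r = (1 - q) / (1 + q)"
  define h where "h k = q ^ (2 * k + 1) * qint (N - k) q + (1 / 2) * (1 - r ^ (N - k))" for k
  have d1: "der_poly q N = (\<Sum>k\<le>N. c k)"
    and d2: "der_poly (- q) N = (\<Sum>k\<le>N. c k * r ^ (N - k))"
    and d3: "der_poly_last_pos q (Suc N) = (\<Sum>k\<le>N. c k * (q ^ (2 * k + 1) * qint (N - k) q))"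
    unfolding c_def r_def
    by (rule der_poly_formula der_poly_minus_formula der_poly_last_pos_formula; use assms(2) nz in blast)+
  have "(\<Sum>w | w \<in> B_derangements N \<and> odd (neg w). q ^ fmaj w) = (1 / 2) * (der_poly q N - der_poly (- q) N)"
    by (simp add: der_poly_minus)
  also have "\<dots> = (\<Sum>k\<le>N. c k * ((1 / 2) * (1 - r ^ (N - k))))"
    unfolding d1 d2 sum_subtractf[symmetric] sum_distrib_left by (intro sum.cong refl) (simp add: algebra_simps)
  finally have "(\<Sum>w\<in>D_derangements n. q ^ Dmaj w) = (\<Sum>k\<le>N. c k * h k)"
    unfolding n(1) sum_Dmaj_eq d3 h_def distrib_left sum.distrib by simp
  also have "\<dots> = (\<Sum>k\<in>{0..n - 2}. c k * h k)"
  proof -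
    have "{..N} = insert N {0..n - 2}" "N \<notin> {0..n - 2}" using n by auto
    \<comment> \<open>The inversion also yields a term for k = N = n - 1. It vanishes since [0] = 0
      and the power of \<open>r\<close> is 1, so the sum stops at n - 2.\<close>
    moreover have "h N = 0" by (simp add: h_def qint_def)
    ultimately show ?thesis by simp
  qed
  also have "\<dots> = dbl_qfact q N * (\<Sum>k=0..n-2. ((-1) ^ k * q ^ (2 * (k choose 2)) / dbl_qfact q k) * h k)"
    unfolding sum_distrib_left c_def by (intro sum.cong refl) simp
  finally show ?thesis unfolding h_def r_def dbl_qfact_def using n by simp
qed

end
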